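(* Let $J\subseteq\{1,\ldots,d\}$ be non-empty with $|J|=r$. For any $\theta_1,\theta_2\in\Theta$ with $\eta_J(\theta_1)=\eta_J(\theta_2)=\eta_0$, the AIRM geodesic between $\mathcal{F}_J(\theta_1)$ and $\mathcal{F}_J(\theta_2)$ lies entirely within $$\mathcal{S}_{\eta_0}=\left\{\begin{pmatrix}A&\eta_0\\ \eta_0^\top&1\end{pmatrix}\in\mathrm{SPD}(r+1):A\in\mathrm{SPD}(r)\right\}.$$ If this geodesic also lies within $\mathcal{M}_J$, then $$d_{\mathrm{AIRM}}(\mathcal{F}_J(\theta_1),\mathcal{F}_J(\theta_2))=d_{\mathcal{F}_J}(\theta_1,\theta_2).$$
   Context: Let $(X,\mathcal{X},\mu)$ be a $\sigma$-finite measure space and let $\mathcal{M}_\mu$ be the set of measurable $p:X\to\mathbb{R}$ with $p>0$ $\mu$-a.e. and $\int_X p\,d\mu=1$. For $p\in\mathcal{M}_\mu$ write $\mathbb{E}_p[u]=\int_X u\,p\,d\mu$ (entrywise for matrices). Fix a reference density $p\in\mathcal{M}_\mu$. Let $B_p$ be the Banach space of ($\mu$-a.e. classes of) measurable $u:X\to\mathbb{R}$ such that $\mathbb{E}_p[\cosh(\alpha u)-1]<\infty$ for some $\alpha>0$ and $\mathbb{E}_p[u]=0$, with norm $\|u\|_p=\inf\{r>0:\mathbb{E}_p[\cosh(u/r)-1]\le 1\}$. For $u\in B_p$ let $K_p(u)=\log\mathbb{E}_p[e^u]\in[0,+\infty]$, $\mathrm{Dom}(K_p)=\{u\in B_p:K_p(u)<\infty\}$,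 with interior $\mathrm{Dom}(K_p)^\circ$ in $B_p$. Fix $d\ge 1$ and $u_1,\ldots,u_d\in B_p$ linearly independent in $L^2(p\cdot\mu)$ (standing assumption). Let $\Theta=\{\theta\in\mathbb{R}^d:\sum_j\theta_ju_j\in\mathrm{Dom}(K_p)^\circ\}$ (open), $\psi(\theta)=K_p(\sum_j\theta_ju_j)$, $p_\theta=e^{\sum_j\theta_ju_j-\psi(\theta)}p$, $\mathcal{N}=\{p_\theta:\theta\in\Theta\}$. For non-empty $J=\{j_1<\cdots<j_r\}\subseteq\{1,\ldots,d\}$ let $V_J(x)=(u_{j_1}(x),\ldots,u_{j_r}(x),1)^\top$, $\eta_J(\theta)=(\mathbb{E}_{p_\theta}[u_k])_{k\in J}\in\mathbb{R}^r$, and let the partial embedding be $\mathcal{F}_J(\theta)=\mathcal{F}_J(p_\theta)=S_J(\theta)=\mathbb{E}_{p_\theta}[V_JV_J^\top]\in\mathrm{SPD}(r+1)$, with image $\mathcal{M}_J=\mathcal{F}_J(\mathcal{N})$. $\mathrm{SPD}(m)$ is the set of real symmetric positive definite $m\times m$ matrices. The affine-invariant Riemannian metric (AIRM) is $\langle\Xi,\Omega\rangle_S=\frac12\mathrm{tr}(S^{-1}\Xi S^{-1}\Omega)$; its unique geodesic from $S_0$ to $S_1$ is $\gamma(t)=S_0^{1/2}(S_0^{-1/2}S_1S_0^{-1/2})^tS_0^{1/2}$, $t\in[0,1]$, and its distance is $d_{\mathrm{AIRM}}(S_0,S_1)=\frac{1}{\sqrt2}\|\log(S_0^{-1/2}S_1S_0^{-1/2})\|_F$.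 The distance $d_{\mathcal{F}_J}(\theta_1,\theta_2)$ is the intrinsic distance on $\mathcal{M}_J$ between $\mathcal{F}_J(\theta_1)$ and $\mathcal{F}_J(\theta_2)$: the infimum of AIRM lengths $\int_0^1\sqrt{\langle\dot\gamma,\dot\gamma\rangle_{\gamma}}\,dt$ over smooth paths $\gamma:[0,1]\to\mathrm{SPD}(r+1)$ from $\mathcal{F}_J(\theta_1)$ to $\mathcal{F}_J(\theta_2)$ contained in $\mathcal{M}_J$. *)

theory Defs
  imports "HOL-Analysis.Analysis"
begin

section \<open>Densities, Orlicz space and cumulant functional\<close>

definition densities :: "'a measure \<Rightarrow> ('a \<Rightarrow> real) set" where
  "densities M = {p \<in> borel_measurable M.
     (AE x in M. 0 < p x) \<and> integrable M p \<and> (\<integral>x. p x \<partial>M) = 1}"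

definition expect :: "'a measure \<Rightarrow> ('a \<Rightarrow> real) \<Rightarrow> ('a \<Rightarrow> real) \<Rightarrow> real" where
  "expect M p f = (\<integral>x. f x * p x \<partial>M)"

text \<open>The expectation of a nonnegative function, possibly infinite.\<close>
definition nn_expect :: "'a measure \<Rightarrow> ('a \<Rightarrow> real) \<Rightarrow> ('a \<Rightarrow> real) \<Rightarrow> ennreal" where
  "nn_expect M p f = (\<integral>\<^sup>+x. ennreal (f x * p x) \<partial>M)"

text \<open>
  Elements of the Banach space are represented by functions rather than by classes modulo
  equality almost everywhere. Membership, the norm and the cumulant functional depend only on
  the class, so that no quotient is formed.
\<close>
definition Bspace :: "'a measure \<Rightarrow> ('a \<Rightarrow> real) \<Rightarrow> ('a \<Rightarrow> real) set" where
  "Bspace M p = {u \<in> borel_measurable M.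
     (\<exists>\<alpha>>0. nn_expect M p (\<lambda>x. cosh (\<alpha> * u x) - 1) < \<infinity>) \<and> expect M p u = 0}"

definition Bnorm :: "'a measure \<Rightarrow> ('a \<Rightarrow> real) \<Rightarrow> ('a \<Rightarrow> real) \<Rightarrow> real" where
  "Bnorm M p u = Inf {r. 0 < r \<and> nn_expect M p (\<lambda>x. cosh (u x / r) - 1) \<le> 1}"

definition cumulant :: "'a measure \<Rightarrow> ('a \<Rightarrow> real) \<Rightarrow> ('a \<Rightarrow> real) \<Rightarrow> ereal" where
  "cumulant M p u =
     (let e = nn_expect M p (\<lambda>x. exp (u x))
      in if e = \<infinity> then \<infinity> else ereal (ln (enn2real e)))"

definition cumulant_dom :: "'a measure \<Rightarrow> ('a \<Rightarrow> real) \<Rightarrow> ('a \<Rightarrow> real) set" where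
  "cumulant_dom M p = {u \<in> Bspace M p. cumulant M p u < \<infinity>}"

text \<open>The interior is taken in the topology of \<^const>\<open>Bnorm\<close> on \<^const>\<open>Bspace\<close>.\<close>
definition cumulant_dom_interior :: "'a measure \<Rightarrow> ('a \<Rightarrow> real) \<Rightarrow> ('a \<Rightarrow> real) set" where
  "cumulant_dom_interior M p = {u \<in> Bspace M p. \<exists>\<epsilon>>0. \<forall>v \<in> Bspace M p.
     Bnorm M p (\<lambda>x. v x - u x) < \<epsilon> \<longrightarrow> v \<in> cumulant_dom M p}"

definition L2_lin_indep :: "'a measure \<Rightarrow> ('a \<Rightarrow> real) \<Rightarrow> ('d::finite \<Rightarrow> 'a \<Rightarrow> real) \<Rightarrow> bool" where
  "L2_lin_indep M p u \<longleftrightarrow>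
     (\<forall>c :: 'd \<Rightarrow> real. (AE x in density M (\<lambda>x. ennreal (p x)). (\<Sum>k\<in>UNIV. c k * u k x) = 0)
        \<longrightarrow> (\<forall>k. c k = 0))"


section \<open>The exponential family\<close>

definition lin_comb :: "('d::finite \<Rightarrow> 'a \<Rightarrow> real) \<Rightarrow> real^'d \<Rightarrow> 'a \<Rightarrow> real" where
  "lin_comb u \<theta> x = (\<Sum>k\<in>UNIV. \<theta> $ k * u k x)"

definition params :: "'a measure \<Rightarrow> ('a \<Rightarrow> real) \<Rightarrow> ('d::finite \<Rightarrow> 'a \<Rightarrow> real) \<Rightarrow> (real^'d) set" where
  "params M p u = {\<theta>. lin_comb u \<theta> \<in> cumulant_dom_interior M p}"

definition log_partition ::
  "'a measure \<Rightarrow> ('a \<Rightarrow> real) \<Rightarrow> ('d::finite \<Rightarrow> 'a \<Rightarrow> real) \<Rightarrow> real^'d \<Rightarrow> real" where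
  "log_partition M p u \<theta> = real_of_ereal (cumulant M p (lin_comb u \<theta>))"

definition exp_density ::
  "'a measure \<Rightarrow> ('a \<Rightarrow> real) \<Rightarrow> ('d::finite \<Rightarrow> 'a \<Rightarrow> real) \<Rightarrow> real^'d \<Rightarrow> 'a \<Rightarrow> real" where
  "exp_density M p u \<theta> x = exp (lin_comb u \<theta> x - log_partition M p u \<theta>) * p x"

definition exp_family ::
  "'a measure \<Rightarrow> ('a \<Rightarrow> real) \<Rightarrow> ('d::finite \<Rightarrow> 'a \<Rightarrow> real) \<Rightarrow> ('a \<Rightarrow> real) set" where
  "exp_family M p u = exp_density M p u ` params M p u"


section \<open>Symmetric positive definite matrices and the affine-invariant metric\<close>

definition SPD :: "(real^'n^'n) set" where
  "SPD = {S. transpose S = S \<and> (\<forall>v. v \<noteq> 0 \<longrightarrow> 0 < v \<bullet> (S *v v))}"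

definition diag_mat :: "('n \<Rightarrow> real) \<Rightarrow> real^'n^'n" where
  "diag_mat a = (\<chi> i k. if i = k then a i else 0)"

text \<open>
  Functional calculus of real symmetric matrices. The result does not depend on the chosen
  spectral decomposition, see \<open>mat_fun_eq\<close> below.
\<close>
definition mat_fun :: "(real \<Rightarrow> real) \<Rightarrow> real^'n^'n \<Rightarrow> real^'n^'n" where
  "mat_fun f S = (THE T. \<exists>Q a. orthogonal_matrix Q
     \<and> S = Q ** diag_mat a ** transpose Q
     \<and> T = Q ** diag_mat (\<lambda>i. f (a i)) ** transpose Q)"

lemma diag_mat_mult_left: "(diag_mat a ** X) $ i $ k = a i * X $ i $ k"
proof -
  have "(diag_mat a ** X) $ i $ k = (\<Sum>l\<in>UNIV. if i = l then a i * X $ l $ k else 0)"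
    unfolding diag_mat_def matrix_matrix_mult_def vec_lambda_beta
    by (rule sum.cong[OF refl]) simp
  then show ?thesis by simp
qed

lemma diag_mat_mult_right: "(X ** diag_mat a) $ i $ k = X $ i $ k * a k"
proof -
  have "(X ** diag_mat a) $ i $ k = (\<Sum>l\<in>UNIV. if l = k then X $ i $ l * a l else 0)"
    unfolding diag_mat_def matrix_matrix_mult_def vec_lambda_beta
    by (rule sum.cong[OF refl]) simp
  then show ?thesis by simp
qed

lemma spectral_fun_unique:
  fixes Q R :: "real^'n^'n"
  assumes Q: "orthogonal_matrix Q" and R: "orthogonal_matrix R"
    and eq: "Q ** diag_mat a ** transpose Q = R ** diag_mat b ** transpose R"
  shows "Q ** diag_mat (\<lambda>i. f (a i)) ** transpose Q
       = R ** diag_mat (\<lambda>i. f (b i)) ** transpose R"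
proof -
  have QQ: "transpose Q ** Q = mat 1" "Q ** transpose Q = mat 1"
    and RR: "transpose R ** R = mat 1" "R ** transpose R = mat 1"
    using Q R unfolding orthogonal_matrix_def by blast+
  define W where "W = transpose R ** Q"
  have "W ** diag_mat a = transpose R ** (Q ** diag_mat a ** transpose Q) ** Q"
    by (simp only: W_def QQ matrix_mul_assoc[symmetric] matrix_mul_rid)
  also have "\<dots> = (transpose R ** R) ** diag_mat b ** transpose R ** Q"
    by (simp only: eq matrix_mul_assoc)
  also have "\<dots> = diag_mat b ** W"
    by (simp only: W_def RR matrix_mul_assoc matrix_mul_lid)
  finally have comm: "W ** diag_mat a = diag_mat b ** W" .
  have 1: "W $ i $ k * a k = b i * W $ i $ k" for i k
    using arg_cong[OF comm, of "\<lambda>Z. Z $ i $ k"]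
    by (simp only: diag_mat_mult_left diag_mat_mult_right)
  have "W ** diag_mat (\<lambda>i. f (a i)) = diag_mat (\<lambda>i. f (b i)) ** W"
    unfolding vec_eq_iff
  proof (intro allI)
    fix i k
    have "W $ i $ k = 0 \<or> a k = b i"
      using 1[of i k] by (metis mult.commute mult_cancel_left)
    then have "W $ i $ k * f (a k) = f (b i) * W $ i $ k"
      by (elim disjE) simp_all
    then show "(W ** diag_mat (\<lambda>i. f (a i))) $ i $ k = (diag_mat (\<lambda>i. f (b i)) ** W) $ i $ k"
      by (simp only: diag_mat_mult_left diag_mat_mult_right)
  qed
  then have "R ** (W ** diag_mat (\<lambda>i. f (a i))) ** transpose Q
           = R ** (diag_mat (\<lambda>i. f (b i)) ** W) ** transpose Q"
    by (simp only:)
  then have "(R ** transpose R) ** Q ** diag_mat (\<lambda>i. f (a i)) ** transpose Q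
           = R ** diag_mat (\<lambda>i. f (b i)) ** transpose R ** (Q ** transpose Q)"
    by (simp only: W_def matrix_mul_assoc)
  then show ?thesis by (simp only: QQ RR matrix_mul_lid matrix_mul_rid)
qed

lemma mat_fun_eq:
  fixes Q :: "real^'n^'n"
  assumes "orthogonal_matrix Q"
  shows "mat_fun f (Q ** diag_mat a ** transpose Q)
       = Q ** diag_mat (\<lambda>i. f (a i)) ** transpose Q"
  unfolding mat_fun_def
proof (rule the_equality)
  show "\<exists>R b. orthogonal_matrix R
     \<and> Q ** diag_mat a ** transpose Q = R ** diag_mat b ** transpose R
     \<and> Q ** diag_mat (\<lambda>i. f (a i)) ** transpose Q = R ** diag_mat (\<lambda>i. f (b i)) ** transpose R"
    using assms by (intro exI[where x=Q] exI[where x=a] conjI refl)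
next
  fix T
  assume "\<exists>R b. orthogonal_matrix R
     \<and> Q ** diag_mat a ** transpose Q = R ** diag_mat b ** transpose R
     \<and> T = R ** diag_mat (\<lambda>i. f (b i)) ** transpose R"
  then obtain R b where R: "orthogonal_matrix R"
    and eq: "Q ** diag_mat a ** transpose Q = R ** diag_mat b ** transpose R"
    and T: "T = R ** diag_mat (\<lambda>i. f (b i)) ** transpose R"
    by blast
  show "T = Q ** diag_mat (\<lambda>i. f (a i)) ** transpose Q"
    unfolding T using spectral_fun_unique[OF assms R eq, of f] by (rule sym)
qed

definition mat_powr :: "real^'n^'n \<Rightarrow> real \<Rightarrow> real^'n^'n" where
  "mat_powr S t = mat_fun (\<lambda>x. x powr t) S"

definition airm :: "real^'n^'n \<Rightarrow> real^'n^'n \<Rightarrow> real^'n^'n \<Rightarrow> real" where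
  "airm S \<Xi> \<Omega> = trace (matrix_inv S ** \<Xi> ** matrix_inv S ** \<Omega>) / 2"

definition airm_geodesic :: "real^'n^'n \<Rightarrow> real^'n^'n \<Rightarrow> real \<Rightarrow> real^'n^'n" where
  "airm_geodesic S0 S1 t =
     mat_powr S0 (1/2) ** mat_powr (mat_powr S0 (-1/2) ** S1 ** mat_powr S0 (-1/2)) t
       ** mat_powr S0 (1/2)"

text \<open>The norm of the type \<^typ>\<open>real^'n^'n\<close> is the Frobenius norm.\<close>
definition airm_dist :: "real^'n^'n \<Rightarrow> real^'n^'n \<Rightarrow> real" where
  "airm_dist S0 S1 =
     norm (mat_fun ln (mat_powr S0 (-1/2) ** S1 ** mat_powr S0 (-1/2))) / sqrt 2"

text \<open>Smoothness on the closed unit interval, with one-sided derivatives of all orders at the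
  end points.\<close>
definition smooth_path :: "(real \<Rightarrow> 'b::real_normed_vector) \<Rightarrow> bool" where
  "smooth_path \<gamma> \<longleftrightarrow> (\<exists>D :: nat \<Rightarrow> real \<Rightarrow> 'b. (\<forall>t\<in>{0..1}. D 0 t = \<gamma> t) \<and>
     (\<forall>n. \<forall>t\<in>{0..1}. (D n has_vector_derivative D (Suc n) t) (at t within {0..1})))"

definition airm_length :: "(real \<Rightarrow> real^'n^'n) \<Rightarrow> real" where
  "airm_length \<gamma> = integral {0..1} (\<lambda>t.
     let v = vector_derivative \<gamma> (at t within {0..1}) in sqrt (airm (\<gamma> t) v v))"

text \<open>Intrinsic distance in a set of SPD matrices. It is \<open>\<infinity>\<close> if no smooth path inside the
  set joins the two points.\<close>
definition intrinsic_dist :: "(real^'n^'n) set \<Rightarrow> real^'n^'n \<Rightarrow> real^'n^'n \<Rightarrow> ereal" where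
  "intrinsic_dist N S0 S1 =
     (INF \<gamma> \<in> {\<gamma>. smooth_path \<gamma> \<and> \<gamma> ` {0..1} \<subseteq> SPD \<inter> N \<and> \<gamma> 0 = S0 \<and> \<gamma> 1 = S1}.
        ereal (airm_length \<gamma>))"


section \<open>Partial embeddings\<close>

text \<open>
  A subset \<open>J = {j\<^sub>1 < \<dots> < j\<^sub>r}\<close> of the index type \<open>'d\<close> is given by its enumeration
  \<open>j :: 'r \<Rightarrow> 'd\<close>, with \<open>CARD('r) = r\<close>. Matrices of size \<open>r + 1\<close> are indexed by
  \<^typ>\<open>'r option\<close>, where \<^const>\<open>None\<close> stands for the last row and column.
\<close>
definition ext_stat :: "('d \<Rightarrow> 'a \<Rightarrow> real) \<Rightarrow> ('r::finite \<Rightarrow> 'd) \<Rightarrow> 'a \<Rightarrow> real^'r option" where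
  "ext_stat u j x = (\<chi> a. case a of Some k \<Rightarrow> u (j k) x | None \<Rightarrow> 1)"

definition partial_mean ::
  "'a measure \<Rightarrow> ('d \<Rightarrow> 'a \<Rightarrow> real) \<Rightarrow> ('r::finite \<Rightarrow> 'd) \<Rightarrow> ('a \<Rightarrow> real) \<Rightarrow> real^'r" where
  "partial_mean M u j q = (\<chi> k. expect M q (u (j k)))"

definition partial_embedding ::
  "'a measure \<Rightarrow> ('d \<Rightarrow> 'a \<Rightarrow> real) \<Rightarrow> ('r::finite \<Rightarrow> 'd) \<Rightarrow> ('a \<Rightarrow> real)
     \<Rightarrow> real^'r option^'r option" where
  "partial_embedding M u j q =
     (\<chi> a b. expect M q (\<lambda>x. ext_stat u j x $ a * ext_stat u j x $ b))"

definition embedded_family ::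
  "'a measure \<Rightarrow> ('a \<Rightarrow> real) \<Rightarrow> ('d::finite \<Rightarrow> 'a \<Rightarrow> real) \<Rightarrow> ('r::finite \<Rightarrow> 'd)
     \<Rightarrow> (real^'r option^'r option) set" where
  "embedded_family M p u j = partial_embedding M u j ` exp_family M p u"

definition embedding_dist ::
  "'a measure \<Rightarrow> ('a \<Rightarrow> real) \<Rightarrow> ('d::finite \<Rightarrow> 'a \<Rightarrow> real) \<Rightarrow> ('r::finite \<Rightarrow> 'd)
     \<Rightarrow> real^'d \<Rightarrow> real^'d \<Rightarrow> ereal" where
  "embedding_dist M p u j \<theta>1 \<theta>2 = intrinsic_dist (embedded_family M p u j)
     (partial_embedding M u j (exp_density M p u \<theta>1))
     (partial_embedding M u j (exp_density M p u \<theta>2))"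

definition bordered :: "real^'r^'r \<Rightarrow> real^'r \<Rightarrow> real^('r::finite) option^'r option" where
  "bordered A \<eta> = (\<chi> a b. case (a, b) of
       (Some i, Some k) \<Rightarrow> A $ i $ k
     | (Some i, None) \<Rightarrow> \<eta> $ i
     | (None, Some k) \<Rightarrow> \<eta> $ k
     | (None, None) \<Rightarrow> 1)"

definition fixed_mean_SPD :: "real^('r::finite) \<Rightarrow> (real^'r option^'r option) set" where
  "fixed_mean_SPD \<eta> = {bordered A \<eta> | A. A \<in> SPD \<and> bordered A \<eta> \<in> SPD}"

end

theory Submission
  imports Defs
begin

text \<open>
  The last column of \<open>S\<^sub>1\<close> and of \<open>S\<^sub>2\<close> is \<open>(\<eta>\<^sub>0, 1)\<close>. With \<open>e\<close> the last unit vector, this says that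
  \<open>S\<^sub>1 e = S\<^sub>2 e\<close>. Write \<open>S\<^sub>1 = R R\<^sup>T\<close> and \<open>S\<^sub>2 = R D R\<^sup>T\<close> with \<open>R\<close> invertible and \<open>D\<close> diagonal and
  positive (\<open>SPD_pair_normal_form\<close>, from the spectral theorem). In these coordinates the geodesic is
  \<open>R D\<^sup>t R\<^sup>T\<close>. The vector \<open>R\<^sup>T e\<close> is fixed by \<open>D\<close>, hence by every power of \<open>D\<close>, so the geodesic keeps the
  last column (\<open>airm_geodesic_fixes\<close>). A positive definite matrix with that last column lies in
  \<open>fixed_mean_SPD \<eta>\<^sub>0\<close>.

  If the geodesic stays in the embedded family, it is one of the paths over which the intrinsic
  distance takes the infimum, and its length is the ambient distance. It remains to see that no smooth
  path \<open>\<gamma>\<close> of positive definite matrices is shorter (\<open>airm_dist_le_length\<close>). The classical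
  argument differentiates the matrix logarithm along \<open>\<gamma>\<close>. The proof here replaces the logarithm by
  the diagonal of a Cholesky factor: the map that sends \<open>S\<close> to the logarithms of the squared lengths
  of the Gram--Schmidt orthogonalisation, with respect to \<open>S\<close>, of a fixed basis. This map does not
  increase lengths, up to the factor \<open>sqrt 2\<close> in the normalisation of the metric, because its derivative
  is the diagonal part of the velocity written in an orthonormal basis
  (\<open>gram_schmidt_length_derivative\<close>, \<open>airm_ge_orthogonal_diagonal\<close>). With the columns of the inverse of
  \<open>R\<^sup>T\<close> as the fixed basis, the end points are already diagonal, and the map takes them to \<open>0\<close> and to the
  logarithms of \<open>D\<close>. The Euclidean distance of these two images, divided by \<open>sqrt 2\<close>, is the ambient
  distance of \<open>S\<^sub>1\<close> and \<open>S\<^sub>2\<close>.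

  All of this needs \<open>S\<^sub>1\<close> and \<open>S\<^sub>2\<close> to be positive definite. Second moments exist because an interior
  parameter can be moved a little in the direction of plus or minus any statistic without leaving the
  domain of the cumulant functional (\<open>params_tilt\<close>), and definiteness follows from linear
  independence of the statistics and the constant \<open>1\<close> (\<open>ext_stat_independent\<close>).
\<close>

section \<open>Spectral theorem\<close>

lemma symmetric_matrix_inner:
  fixes A :: "real^'n^'n"
  assumes "transpose A = A"
  shows "(A *v x) \<bullet> y = x \<bullet> (A *v y)"
  by (metis assms dot_lmul_matrix transpose_matrix_vector)

text \<open>A maximiser of the quadratic form of \<open>A\<close> on the unit sphere of an invariant subspace is an
  eigenvector: the first-order condition makes the component of \<open>A *v v\<close> orthogonal to \<open>v\<close>
  vanish.\<close>
lemma symmetric_eigenvector_in_invariant_subspace: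
  fixes A :: "real^'n^'n"
  assumes sym: "transpose A = A" and V: "subspace V" and inv: "\<And>v. v \<in> V \<Longrightarrow> A *v v \<in> V"
    and nontrivial: "\<exists>v\<in>V. v \<noteq> 0"
  obtains v l where "v \<in> V" "norm v = 1" "A *v v = l *\<^sub>R v"
proof -
  let ?C = "V \<inter> sphere 0 1"
  obtain v0 where v0: "v0 \<in> V" "v0 \<noteq> 0" using nontrivial by blast
  have "v0 /\<^sub>R norm v0 \<in> ?C"
    using v0 V by (auto simp: subspace_scale)
  then have ne: "?C \<noteq> {}" by blast
  have "compact ?C"
    using closed_subspace[OF V] by (simp add: closed_Int_compact)
  moreover have "continuous_on ?C (\<lambda>v. v \<bullet> (A *v v))"
    by (intro continuous_intros)
  ultimately obtain v where v: "v \<in> ?C"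
    and max: "\<And>w. w \<in> ?C \<Longrightarrow> w \<bullet> (A *v w) \<le> v \<bullet> (A *v v)"
    using continuous_attains_sup[OF _ ne] by blast
  define l where "l = v \<bullet> (A *v v)"
  have nv: "v \<bullet> v = 1" using v by (simp add: norm_eq_1)
  have bound: "w \<bullet> (A *v w) \<le> l * (w \<bullet> w)" if "w \<in> V" for w
  proof (cases "w = 0")
    case False
    have "w /\<^sub>R norm w \<in> ?C" using that V False by (auto simp: subspace_scale)
    from max[OF this] have "(w \<bullet> (A *v w)) / (norm w)\<^sup>2 \<le> l"
      by (simp add: l_def matrix_vector_mult_scaleR power2_eq_square field_simps)
    then show ?thesis
      using False by (simp add: field_simps power2_norm_eq_inner)
  qed simp
  have orth: "w \<bullet> (A *v v) = 0" if w: "w \<in> V" "w \<bullet> v = 0" for w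
  proof (rule ccontr)
    assume b0: "w \<bullet> (A *v v) \<noteq> 0"
    define b c where "b = w \<bullet> (A *v v)" and "c = w \<bullet> (A *v w) - l * (w \<bullet> w)"
    have ineq: "2 * t * b + t\<^sup>2 * c \<le> 0" for t
    proof -
      have "v + t *\<^sub>R w \<in> V" using v w V by (simp add: subspace_add subspace_scale)
      from bound[OF this] show ?thesis
        using w nv symmetric_matrix_inner[OF sym, of v w]
        by (simp add: matrix_vector_right_distrib matrix_vector_mult_scaleR inner_add_left
            inner_add_right b_def c_def l_def[symmetric] inner_commute power2_eq_square
            algebra_simps)
    qed
    have "c \<le> 0" using bound[OF w(1)] by (simp add: c_def)
    \<comment> \<open>the slope \<open>2 b\<close> at \<open>0\<close> beats the quadratic term for a step of this size; the summand \<open>1\<close>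
      avoids a division by zero\<close>
    define t where "t = b / (1 - c)"
    have "2 * t * b + t\<^sup>2 * c = b\<^sup>2 * (2 - c) / (1 - c)\<^sup>2"
      using \<open>c \<le> 0\<close> by (simp add: t_def power2_eq_square divide_simps) (simp add: algebra_simps)
    moreover have "\<dots> > 0" using b0 \<open>c \<le> 0\<close> by (simp add: b_def)
    ultimately show False using ineq[of t] by simp
  qed
  define w where "w = A *v v - l *\<^sub>R v"
  have wV: "w \<in> V" using v V inv by (simp add: w_def subspace_diff subspace_scale)
  have wv: "w \<bullet> v = 0"
    unfolding w_def inner_diff_left inner_scaleR_left nv by (simp add: l_def inner_commute)
  have "w \<bullet> w = w \<bullet> (A *v v) - l * (w \<bullet> v)"
    by (subst (2) w_def) (simp add: inner_diff_right)
  then have "w = 0" using orth[OF wV wv] wv by simp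
  then show thesis using that[of v l] v by (simp add: w_def)
qed

text \<open>The orthogonal complement of a set of eigenvectors is invariant, so it contains a further
  eigenvector until the set spans the space.\<close>
lemma orthonormal_eigenvectors:
  fixes A :: "real^'n^'n"
  assumes sym: "transpose A = A" and "k \<le> CARD('n)"
  shows "\<exists>B. finite B \<and> card B = k \<and> pairwise orthogonal B \<and>
           (\<forall>b\<in>B. norm b = 1 \<and> (\<exists>l. A *v b = l *\<^sub>R b))"
  using assms(2)
proof (induction k)
  case 0
  then show ?case by (intro exI[of _ "{}"]) simp
next
  case (Suc k)
  then obtain B where B: "finite B" "card B = k" "pairwise orthogonal B"
    "\<And>b. b \<in> B \<Longrightarrow> norm b = 1" "\<And>b. b \<in> B \<Longrightarrow> \<exists>l. A *v b = l *\<^sub>R b" by auto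
  define V where "V = {v. \<forall>b\<in>B. b \<bullet> v = 0}"
  have sub: "subspace V"
    by (simp add: V_def subspace_def inner_add_right)
  have inv: "A *v v \<in> V" if "v \<in> V" for v
    unfolding V_def
  proof (intro CollectI ballI)
    fix b assume b: "b \<in> B"
    then obtain l where "A *v b = l *\<^sub>R b" using B by blast
    then show "b \<bullet> (A *v v) = 0"
      using symmetric_matrix_inner[OF sym, of b v] that b by (simp add: V_def)
  qed
  have "span B \<noteq> UNIV"
  proof
    assume "span B = UNIV"
    then have "CARD('n) \<le> card B"
      using dim_le_card'[OF B(1)] dim_span[of B] dim_UNIV[where 'a="real^'n"] by simp
    then show False using Suc B by simp
  qed
  then have "span B \<subset> span UNIV" by auto
  then obtain v0 where v0: "v0 \<noteq> 0" "\<And>x. x \<in> span B \<Longrightarrow> orthogonal v0 x"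
    by (rule orthogonal_to_subspace_exists_gen) blast
  have "v0 \<in> V"
    using v0(2) span_base by (fastforce simp: V_def orthogonal_def inner_commute)
  then have "\<exists>v\<in>V. v \<noteq> 0" using v0(1) by blast
  then obtain v l where v: "v \<in> V" "norm v = 1" "A *v v = l *\<^sub>R v"
    using symmetric_eigenvector_in_invariant_subspace[OF sym sub inv] by blast
  have "v \<notin> B"
  proof
    assume "v \<in> B"
    then have "v \<bullet> v = 0" using v by (auto simp: V_def)
    then show False using v by simp
  qed
  moreover have "pairwise orthogonal (insert v B)"
    using B v by (auto simp: pairwise_insert V_def orthogonal_def inner_commute)
  ultimately show ?case
    using B v Suc by (intro exI[of _ "insert v B"]) auto
qed

theorem spectral_decomposition:
  fixes A :: "real^'n^'n"
  assumes sym: "transpose A = A"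
  obtains Q a where "orthogonal_matrix Q" "A = Q ** diag_mat a ** transpose Q"
proof -
  obtain B where B: "finite B" "card B = CARD('n)" "pairwise orthogonal B"
    "\<And>b. b \<in> B \<Longrightarrow> norm b = 1" "\<And>b. b \<in> B \<Longrightarrow> \<exists>l. A *v b = l *\<^sub>R b"
    using orthonormal_eigenvectors[OF sym order_refl] by auto
  obtain f where f: "bij_betw f (UNIV :: 'n set) B"
    using B finite_same_card_bij[of "UNIV :: 'n set" B] by auto
  have fB: "f k \<in> B" for k using f by (auto simp: bij_betw_def)
  have "\<forall>k. \<exists>l. A *v f k = l *\<^sub>R f k" using B(5) fB by blast
  from choice[OF this] obtain a where a: "\<And>k. A *v f k = a k *\<^sub>R f k" by blast
  define Q where "Q = (\<chi> i k. f k $ i)"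
  have col: "column k Q = f k" for k by (simp add: Q_def column_def vec_eq_iff)
  have Q: "orthogonal_matrix Q"
    unfolding orthogonal_matrix_orthonormal_columns col
    using B(3,4) fB bij_betw_imp_inj_on[OF f] by (simp add: pairwise_def inj_eq)
  have "A ** Q = Q ** diag_mat a"
  proof -
    have "(A ** Q) $ i $ k = (Q ** diag_mat a) $ i $ k" for i k
    proof -
      have "(A ** Q) $ i $ k = (A *v f k) $ i"
        unfolding matrix_matrix_mult_def matrix_vector_mult_def Q_def vec_lambda_beta ..
      also have "\<dots> = (Q ** diag_mat a) $ i $ k"
        unfolding a diag_mat_mult_right by (simp add: Q_def)
      finally show ?thesis .
    qed
    then show ?thesis by (simp add: vec_eq_iff)
  qed
  then have "Q ** diag_mat a ** transpose Q = A ** (Q ** transpose Q)"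
    by (simp add: matrix_mul_assoc)
  also have "\<dots> = A" using Q by (simp add: orthogonal_matrix_def)
  finally show thesis using that[OF Q, of a] by simp
qed

section \<open>Positive definite matrices\<close>

lemma matrix_inv_eqI:
  fixes A :: "real^'n^'n"
  assumes "A ** B = mat 1"
  shows "matrix_inv A = B"
proof -
  have BA: "B ** A = mat 1" using assms by (simp add: matrix_left_right_inverse)
  have "A ** matrix_inv A = mat 1 \<and> matrix_inv A ** A = mat 1"
    unfolding matrix_inv_def by (rule someI[of _ B]) (use assms BA in blast)
  then have "B ** A ** matrix_inv A = B" by (simp add: matrix_mul_assoc[symmetric])
  then show ?thesis using BA by simp
qed

lemma diag_mat_mult: "diag_mat a ** diag_mat b = diag_mat (\<lambda>i. a i * b i)"
  by (simp add: vec_eq_iff diag_mat_mult_left) (simp add: diag_mat_def)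

lemma transpose_diag_mat [simp]: "transpose (diag_mat a) = diag_mat a"
  by (auto simp: transpose_def diag_mat_def vec_eq_iff)

lemma diag_mat_one: "diag_mat (\<lambda>_. 1) = mat 1"
  by (simp add: diag_mat_def mat_def)

lemma conj_diag_mat_entry:
  "(R ** diag_mat a ** transpose R) $ i $ k = (\<Sum>l\<in>UNIV. R $ i $ l * a l * R $ k $ l)"
  unfolding matrix_matrix_mult_def[of "R ** diag_mat a"]
  by (simp add: diag_mat_mult_right transpose_def)

lemma diag_mat_vector: "(diag_mat a *v y) $ i = a i * y $ i"
proof -
  have "(diag_mat a *v y) $ i = (\<Sum>k\<in>UNIV. if i = k then a i * y $ k else 0)"
    unfolding diag_mat_def matrix_vector_mult_def vec_lambda_beta
    by (rule sum.cong[OF refl]) simp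
  then show ?thesis by simp
qed

lemma SPD_I:
  assumes "transpose S = S" "\<And>v. v \<noteq> 0 \<Longrightarrow> 0 < v \<bullet> (S *v v)"
  shows "S \<in> SPD"
  using assms by (simp add: SPD_def)

lemma SPD_D:
  assumes "S \<in> SPD"
  shows "transpose S = S" "v \<noteq> 0 \<Longrightarrow> 0 < v \<bullet> (S *v v)"
  using assms by (simp_all add: SPD_def)

lemma SPD_congruence:
  fixes S P :: "real^'n^'n"
  assumes S: "S \<in> SPD" and P: "invertible P"
  shows "P ** S ** transpose P \<in> SPD"
proof (rule SPD_I)
  show "transpose (P ** S ** transpose P) = P ** S ** transpose P"
    using SPD_D(1)[OF S] by (simp add: matrix_transpose_mul matrix_mul_assoc)
next
  fix v :: "real^'n" assume v: "v \<noteq> 0"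
  have "invertible (transpose P)" using P by (rule transpose_invertible)
  then have "transpose P *v v \<noteq> 0"
    using v by (metis invertible_left_inverse matrix_left_invertible_ker)
  from SPD_D(2)[OF S this]
  show "0 < v \<bullet> ((P ** S ** transpose P) *v v)"
    by (simp add: matrix_vector_mul_assoc[symmetric] dot_lmul_matrix)
qed

lemma diag_mat_SPD:
  fixes a :: "'n::finite \<Rightarrow> real"
  assumes "\<And>i. 0 < a i"
  shows "diag_mat a \<in> SPD"
proof (rule SPD_I)
  fix v :: "real^'n" assume v: "v \<noteq> 0"
  obtain i where "v $ i \<noteq> 0" using v by (auto simp: vec_eq_iff)
  then have "0 < a i * (v $ i)\<^sup>2" using assms by simp
  then have "0 < (\<Sum>i\<in>UNIV. a i * (v $ i)\<^sup>2)"
    by (intro sum_pos2[of _ i]) (auto simp: assms less_imp_le)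
  then show "0 < v \<bullet> (diag_mat a *v v)"
    by (simp add: inner_vec_def diag_mat_vector power2_eq_square mult_ac)
qed simp

lemma conj_diag_mat_SPD:
  fixes R :: "real^'n^'n"
  assumes "invertible R" "\<And>i. 0 < a i"
  shows "R ** diag_mat a ** transpose R \<in> SPD"
  by (intro SPD_congruence diag_mat_SPD assms)

lemma SPD_spectral:
  fixes S :: "real^'n^'n"
  assumes S: "S \<in> SPD"
  obtains Q a where "orthogonal_matrix Q" "\<And>i. 0 < a i" "S = Q ** diag_mat a ** transpose Q"
proof -
  obtain Q a where Q: "orthogonal_matrix Q" and eq: "S = Q ** diag_mat a ** transpose Q"
    using spectral_decomposition[OF SPD_D(1)[OF S]] by blast
  have QQ: "transpose Q ** Q = mat 1" using Q by (simp add: orthogonal_matrix)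
  have inv: "invertible (transpose Q)"
    using Q by (auto simp: invertible_def orthogonal_matrix_def)
  have "transpose Q ** S ** transpose (transpose Q) = (transpose Q ** Q) ** diag_mat a ** (transpose Q ** Q)"
    unfolding eq by (simp only: matrix_mul_assoc transpose_transpose)
  then have "diag_mat a \<in> SPD"
    using SPD_congruence[OF S inv] by (simp add: QQ)
  then have "0 < axis i 1 \<bullet> (diag_mat a *v axis i 1)" for i
    by (rule SPD_D(2)) (simp add: axis_eq_0_iff)
  then have "0 < a i" for i
    by (simp add: inner_axis' matrix_vector_mult_basis column_def diag_mat_def)
  then show thesis using that[OF Q _ eq] by blast
qed

section \<open>The Frobenius norm and the affine-invariant metric\<close>

lemma norm_matrix_power2: "(norm (X :: real^'n^'m))\<^sup>2 = trace (X ** transpose X)"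
  by (simp add: power2_norm_eq_inner inner_vec_def trace_def matrix_matrix_mult_def transpose_def)

lemma norm_orthogonal_conj:
  fixes X Q :: "real^'n^'n"
  assumes "orthogonal_matrix Q"
  shows "norm (Q ** X ** transpose Q) = norm X"
proof -
  have Q: "transpose Q ** Q = mat 1" using assms by (simp add: orthogonal_matrix)
  have "(norm (Q ** X ** transpose Q))\<^sup>2
      = trace (Q ** (X ** (transpose Q ** Q) ** transpose X ** transpose Q))"
    by (simp add: norm_matrix_power2 matrix_transpose_mul matrix_mul_assoc)
  also have "\<dots> = trace ((X ** transpose X ** transpose Q) ** Q)"
    by (subst trace_mul_sym) (simp add: Q)
  also have "\<dots> = trace (X ** transpose X ** (transpose Q ** Q))"
    by (simp only: matrix_mul_assoc)
  also have "\<dots> = (norm X)\<^sup>2" by (simp add: Q norm_matrix_power2)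
  finally show ?thesis by (simp add: power2_eq_iff_nonneg)
qed

lemma norm_diag_mat: "norm (diag_mat a) = norm (\<chi> i. a i)"
proof -
  have "(norm (diag_mat a))\<^sup>2 = (norm (\<chi> i. a i))\<^sup>2"
    unfolding norm_matrix_power2 transpose_diag_mat diag_mat_mult
    by (simp add: trace_def diag_mat_def power2_norm_eq_inner inner_vec_def)
  then show ?thesis by (simp add: power2_eq_iff_nonneg)
qed

text \<open>In an \<open>S\<close>-orthonormal frame, the columns of \<open>W\<close>, the metric at \<open>S\<close> is half the squared
  Frobenius norm, because \<open>matrix_inv S = W ** transpose W\<close>.\<close>
lemma airm_orthonormal_frame:
  fixes S W X :: "real^'n^'n"
  assumes W: "transpose W ** S ** W = mat 1" and X: "transpose X = X"
  shows "airm S X X = (norm (transpose W ** X ** W))\<^sup>2 / 2"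
proof -
  have "S ** W ** transpose W = mat 1"
    using W matrix_left_right_inverse[of "transpose W" "S ** W"] by (simp add: matrix_mul_assoc)
  then have inv: "matrix_inv S = W ** transpose W"
    by (intro matrix_inv_eqI) (simp add: matrix_mul_assoc)
  have "trace (matrix_inv S ** X ** matrix_inv S ** X)
      = trace (W ** (transpose W ** X ** W ** transpose W ** X))"
    by (simp add: inv matrix_mul_assoc)
  also have "\<dots> = trace ((transpose W ** X ** W) ** transpose (transpose W ** X ** W))"
    by (subst trace_mul_sym) (simp add: X matrix_transpose_mul matrix_mul_assoc)
  finally show ?thesis by (simp add: airm_def norm_matrix_power2)
qed

section \<open>Geodesics in simultaneously diagonalising coordinates\<close>

text \<open>If the orthogonal matrix \<open>Q\<close> diagonalises \<open>mat_powr S0 (-1/2) ** S1 ** mat_powr S0 (-1/2)\<close>, then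
  \<open>R = mat_powr S0 (1/2) ** Q\<close> works, because the functional calculus acts on the diagonal factor
  alone.\<close>
theorem SPD_pair_normal_form:
  fixes S0 S1 :: "real^'n^'n"
  assumes S0: "S0 \<in> SPD" and S1: "S1 \<in> SPD"
  obtains R :: "real^'n^'n" and d where "invertible R" "\<And>i. 0 < d i"
    "S0 = R ** transpose R" "S1 = R ** diag_mat d ** transpose R"
    "\<And>t. airm_geodesic S0 S1 t = R ** diag_mat (\<lambda>i. d i powr t) ** transpose R"
    "airm_dist S0 S1 = norm (\<chi> i. ln (d i)) / sqrt 2"
proof -
  obtain P a where P: "orthogonal_matrix P" and a: "\<And>i. 0 < a i"
    and S0_eq: "S0 = P ** diag_mat a ** transpose P"
    using SPD_spectral[OF S0] by blast
  have PP: "transpose P ** P = mat 1" "P ** transpose P = mat 1"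
    using P by (simp_all add: orthogonal_matrix_def)
  define H where "H = mat_powr S0 (1/2)"
  define K where "K = mat_powr S0 (-1/2)"
  have H: "H = P ** diag_mat (\<lambda>i. a i powr (1/2)) ** transpose P"
    and K: "K = P ** diag_mat (\<lambda>i. a i powr (-1/2)) ** transpose P"
    unfolding H_def K_def mat_powr_def S0_eq by (rule mat_fun_eq[OF P])+
  have mult: "(P ** diag_mat b ** transpose P) ** (P ** diag_mat c ** transpose P)
      = P ** diag_mat (\<lambda>i. b i * c i) ** transpose P" for b c
  proof -
    have "(P ** diag_mat b ** transpose P) ** (P ** diag_mat c ** transpose P)
        = P ** (diag_mat b ** (transpose P ** P) ** diag_mat c) ** transpose P"
      by (simp only: matrix_mul_assoc)
    then show ?thesis by (simp add: PP diag_mat_mult)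
  qed
  have HH: "H ** H = S0"
    unfolding H mult S0_eq by (simp add: powr_add[symmetric] a less_imp_le)
  have HK: "H ** K = mat 1"
    unfolding H K mult using a by (simp add: powr_add[symmetric] less_imp_neq[OF a, symmetric] diag_mat_one PP)
  then have KH: "K ** H = mat 1" by (simp add: matrix_left_right_inverse)
  have tH: "transpose H = H" and tK: "transpose K = K"
    unfolding H K by (simp_all add: matrix_transpose_mul matrix_mul_assoc)
  have invK: "invertible K" using HK KH by (auto simp: invertible_def)
  have "K ** S1 ** K \<in> SPD" using SPD_congruence[OF S1 invK] by (simp add: tK)
  then obtain Q d where Q: "orthogonal_matrix Q" and d: "\<And>i. 0 < d i"
    and B: "K ** S1 ** K = Q ** diag_mat d ** transpose Q"
    using SPD_spectral by blast
  have QQ: "transpose Q ** Q = mat 1" "Q ** transpose Q = mat 1"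
    using Q by (simp_all add: orthogonal_matrix_def)
  define R where "R = H ** Q"
  have tR: "transpose R = transpose Q ** H" by (simp add: R_def matrix_transpose_mul tH)
  have "R ** (transpose Q ** K) = H ** (Q ** transpose Q) ** K"
    by (simp only: R_def matrix_mul_assoc)
  then have "R ** (transpose Q ** K) = mat 1" by (simp add: QQ HK)
  then have 1: "invertible R" using invertible_right_inverse by blast
  have "R ** transpose R = H ** (Q ** transpose Q) ** H"
    by (simp only: tR) (simp only: R_def matrix_mul_assoc)
  then have 2: "S0 = R ** transpose R" by (simp add: QQ HH)
  have "R ** diag_mat d ** transpose R = H ** (K ** S1 ** K) ** H"
    by (simp only: tR B) (simp only: R_def matrix_mul_assoc)
  also have "\<dots> = (H ** K) ** S1 ** (K ** H)" by (simp only: matrix_mul_assoc)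
  finally have 3: "S1 = R ** diag_mat d ** transpose R" by (simp add: HK KH)
  have 4: "airm_geodesic S0 S1 t = R ** diag_mat (\<lambda>i. d i powr t) ** transpose R" for t
  proof -
    have "airm_geodesic S0 S1 t = H ** mat_powr (K ** S1 ** K) t ** H"
      by (simp add: airm_geodesic_def H_def K_def)
    also have "mat_powr (K ** S1 ** K) t = Q ** diag_mat (\<lambda>i. d i powr t) ** transpose Q"
      unfolding mat_powr_def B by (rule mat_fun_eq[OF Q])
    finally show ?thesis by (simp only: tR) (simp only: R_def matrix_mul_assoc)
  qed
  have "mat_fun ln (K ** S1 ** K) = Q ** diag_mat (\<lambda>i. ln (d i)) ** transpose Q"
    unfolding B by (rule mat_fun_eq[OF Q])
  then have 5: "airm_dist S0 S1 = norm (\<chi> i. ln (d i)) / sqrt 2"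
    unfolding airm_dist_def K_def[symmetric] by (simp add: norm_orthogonal_conj[OF Q] norm_diag_mat)
  from that[OF 1 d 2 3 4 5] show thesis .
qed

text \<open>In the normal form, \<open>transpose R *v e\<close> is an eigenvector of \<open>diag_mat d\<close> for the eigenvalue \<open>1\<close>,
  or zero; powers of \<open>d\<close> do not move it.\<close>
lemma airm_geodesic_fixes:
  fixes S0 S1 :: "real^'n^'n"
  assumes S: "S0 \<in> SPD" "S1 \<in> SPD" and eq: "S0 *v e = S1 *v e"
  shows "airm_geodesic S0 S1 t *v e = S0 *v e"
proof -
  obtain R :: "real^'n^'n" and d where R: "invertible R" and d: "\<And>i. 0 < d i"
    and S0: "S0 = R ** transpose R" and S1: "S1 = R ** diag_mat d ** transpose R"
    and geo: "\<And>t. airm_geodesic S0 S1 t = R ** diag_mat (\<lambda>i. d i powr t) ** transpose R"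
    using SPD_pair_normal_form[OF S] by metis
  define y where "y = transpose R *v e"
  obtain R' where R': "R' ** R = mat 1" using R by (auto simp: invertible_def)
  have "R *v y = R *v (diag_mat d *v y)"
    using eq by (simp add: S0 S1 y_def matrix_vector_mul_assoc[symmetric])
  then have "R' *v (R *v y) = R' *v (R *v (diag_mat d *v y))" by simp
  then have y: "y = diag_mat d *v y" by (simp add: matrix_vector_mul_assoc matrix_mul_assoc R')
  have "(diag_mat (\<lambda>i. d i powr t) *v y) $ i = y $ i" for i
  proof -
    have "y $ i = d i * y $ i" using arg_cong[OF y, of "\<lambda>z. z $ i"] unfolding diag_mat_vector .
    then have "y $ i = 0 \<or> d i = 1" by simp
    then show ?thesis unfolding diag_mat_vector by auto
  qed
  then have "diag_mat (\<lambda>i. d i powr t) *v y = y" by (simp add: vec_eq_iff)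
  moreover have "airm_geodesic S0 S1 t *v e = R *v (diag_mat (\<lambda>i. d i powr t) *v y)"
    by (simp only: geo y_def matrix_vector_mul_assoc matrix_mul_assoc)
  ultimately show ?thesis by (simp add: S0 y_def matrix_vector_mul_assoc[symmetric])
qed

lemma airm_geodesic_SPD:
  fixes S0 S1 :: "real^'n^'n"
  assumes "S0 \<in> SPD" "S1 \<in> SPD"
  shows "airm_geodesic S0 S1 t \<in> SPD"
proof -
  obtain R :: "real^'n^'n" and d where R: "invertible R" and d: "\<And>i. 0 < d i"
    and geo: "\<And>t. airm_geodesic S0 S1 t = R ** diag_mat (\<lambda>i. d i powr t) ** transpose R"
    using SPD_pair_normal_form[OF assms] by metis
  have "0 < d i powr t" for i using d[of i] by simp
  with R show ?thesis unfolding geo by (rule conj_diag_mat_SPD)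
qed

lemma airm_geodesic_endpoints:
  fixes S0 S1 :: "real^'n^'n"
  assumes "S0 \<in> SPD" "S1 \<in> SPD"
  shows "airm_geodesic S0 S1 0 = S0" "airm_geodesic S0 S1 1 = S1"
proof -
  obtain R :: "real^'n^'n" and d where d: "\<And>i. 0 < d i"
    and S: "S0 = R ** transpose R" "S1 = R ** diag_mat d ** transpose R"
    and geo: "\<And>t. airm_geodesic S0 S1 t = R ** diag_mat (\<lambda>i. d i powr t) ** transpose R"
    using SPD_pair_normal_form[OF assms] by metis
  show "airm_geodesic S0 S1 0 = S0"
    unfolding geo using S d less_imp_neq[OF d] by (simp add: diag_mat_one)
  show "airm_geodesic S0 S1 1 = S1"
    unfolding geo using S d by (simp add: less_imp_le)
qed

lemma has_vector_derivative_vec: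
  fixes f :: "real \<Rightarrow> 'b::euclidean_space^'n"
  assumes "\<And>i. ((\<lambda>t. f t $ i) has_vector_derivative D $ i) (at t within T)"
  shows "(f has_vector_derivative D) (at t within T)"
  unfolding has_vector_derivative_def
proof (subst has_derivative_componentwise_within, intro ballI)
  fix b :: "'b^'n" assume "b \<in> Basis"
  then obtain i u where b: "b = axis i u" by (auto simp: Basis_vec_def)
  have "((\<lambda>x. f x $ i \<bullet> u) has_derivative (\<lambda>x. (x *\<^sub>R D $ i) \<bullet> u)) (at t within T)"
    using assms[of i, unfolded has_vector_derivative_def] by (rule has_derivative_inner_left)
  then show "((\<lambda>x. f x \<bullet> b) has_derivative (\<lambda>x. x *\<^sub>R D \<bullet> b)) (at t within T)"
    by (simp add: b inner_axis)
qed

lemma conj_diag_powr_derivative: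
  fixes R :: "real^'n^'n"
  assumes "\<And>i. 0 < d i"
  shows "((\<lambda>t. R ** diag_mat (\<lambda>i. c i * d i powr t) ** transpose R) has_vector_derivative
           R ** diag_mat (\<lambda>i. c i * ln (d i) * d i powr t) ** transpose R) (at t within T)"
proof (intro has_vector_derivative_vec)
  have powr: "((\<lambda>t. d l powr t) has_real_derivative ln (d l) * d l powr t) (at t within T)" for l
    using assms[of l] by (auto simp: powr_def intro!: derivative_eq_intros)
  fix i k
  show "((\<lambda>t. (R ** diag_mat (\<lambda>i. c i * d i powr t) ** transpose R) $ i $ k) has_vector_derivative
     (R ** diag_mat (\<lambda>i. c i * ln (d i) * d i powr t) ** transpose R) $ i $ k) (at t within T)"
    unfolding conj_diag_mat_entry has_real_derivative_iff_has_vector_derivative[symmetric]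
    by (rule derivative_eq_intros powr refl)+ (simp add: mult_ac)
qed

lemma airm_geodesic_smooth:
  fixes S0 S1 :: "real^'n^'n"
  assumes "S0 \<in> SPD" "S1 \<in> SPD"
  shows "smooth_path (airm_geodesic S0 S1)"
proof -
  obtain R :: "real^'n^'n" and d where d: "\<And>i. 0 < d i"
    and geo: "\<And>t. airm_geodesic S0 S1 t = R ** diag_mat (\<lambda>i. d i powr t) ** transpose R"
    using SPD_pair_normal_form[OF assms] by metis
  show ?thesis
    unfolding smooth_path_def
  proof (intro exI[of _ "\<lambda>n t. R ** diag_mat (\<lambda>i. ln (d i) ^ n * d i powr t) ** transpose R"] conjI
      ballI allI)
    fix n :: nat and t :: real
    show "((\<lambda>t. R ** diag_mat (\<lambda>i. ln (d i) ^ n * d i powr t) ** transpose R) has_vector_derivative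
       R ** diag_mat (\<lambda>i. ln (d i) ^ Suc n * d i powr t) ** transpose R) (at t within {0..1})"
      using conj_diag_powr_derivative[where d = d and R = R and c = "\<lambda>i. ln (d i) ^ n", OF d] by (simp add: mult.commute)
  qed (simp add: geo)
qed

text \<open>In the normal form, the matrix \<open>transpose (matrix_inv R) ** diag_mat (\<lambda>i. d i powr (- t / 2))\<close> is
  an orthonormal frame at the point with parameter \<open>t\<close>. The velocity in this frame is
  \<open>diag_mat (\<lambda>i. ln (d i))\<close>, which does not depend on \<open>t\<close>, so the speed is constant.\<close>
lemma airm_geodesic_length:
  fixes S0 S1 :: "real^'n^'n"
  assumes "S0 \<in> SPD" "S1 \<in> SPD"
  shows "airm_length (airm_geodesic S0 S1) = airm_dist S0 S1"
proof -
  obtain R :: "real^'n^'n" and d where R: "invertible R" and d: "\<And>i. 0 < d i"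
    and geo: "\<And>t. airm_geodesic S0 S1 t = R ** diag_mat (\<lambda>i. d i powr t) ** transpose R"
    and dist: "airm_dist S0 S1 = norm (\<chi> i. ln (d i)) / sqrt 2"
    using SPD_pair_normal_form[OF assms] by metis
  obtain R' where R': "R' ** R = mat 1" using R by (auto simp: invertible_def)
  have tR': "transpose R ** transpose R' = mat 1"
    by (simp add: matrix_transpose_mul[symmetric] R')
  let ?\<gamma> = "airm_geodesic S0 S1"
  have speed: "(let v = vector_derivative ?\<gamma> (at t within {0..1}) in sqrt (airm (?\<gamma> t) v v))
      = airm_dist S0 S1" if t: "t \<in> {0..1}" for t
  proof -
    define X where "X = R ** diag_mat (\<lambda>i. ln (d i) * d i powr t) ** transpose R"
    define W where "W = transpose R' ** diag_mat (\<lambda>i. d i powr (- t / 2))"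
    have "(?\<gamma> has_vector_derivative X) (at t within {0..1})"
      using conj_diag_powr_derivative[where d = d and R = R and c = "\<lambda>_. 1", OF d] by (simp add: geo[abs_def] X_def)
    then have v: "vector_derivative ?\<gamma> (at t within {0..1}) = X"
      using t by (intro vector_derivative_within_closed_interval) auto
    have frame: "transpose W ** (R ** diag_mat a ** transpose R) ** W
        = diag_mat (\<lambda>i. a i * d i powr (- t))" for a
    proof -
      have "transpose W ** (R ** diag_mat a ** transpose R) ** W
         = diag_mat (\<lambda>i. d i powr (- t / 2)) ** (R' ** R) ** diag_mat a **
           (transpose R ** transpose R') ** diag_mat (\<lambda>i. d i powr (- t / 2))"
        by (simp add: W_def matrix_transpose_mul matrix_mul_assoc)
      also have "\<dots> = diag_mat (\<lambda>i. a i * (d i powr (- t / 2) * d i powr (- t / 2)))"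
        by (simp add: R' tR' diag_mat_mult mult_ac)
      finally show ?thesis by (simp add: powr_add[symmetric])
    qed
    have 1: "transpose W ** ?\<gamma> t ** W = mat 1"
      unfolding geo frame using less_imp_neq[OF d]
      by (simp add: powr_add[symmetric] diag_mat_one[symmetric])
    have 2: "transpose W ** X ** W = diag_mat (\<lambda>i. ln (d i))"
      unfolding X_def frame using less_imp_neq[OF d]
      by (simp add: powr_add[symmetric] mult.assoc)
    have "transpose X = X" by (simp add: X_def matrix_transpose_mul matrix_mul_assoc)
    from airm_orthonormal_frame[OF 1 this]
    have "airm (?\<gamma> t) X X = (norm (\<chi> i. ln (d i)))\<^sup>2 / 2" unfolding 2 norm_diag_mat .
    then have "sqrt (airm (?\<gamma> t) X X) = norm (\<chi> i. ln (d i)) / sqrt 2"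
      by (simp only: real_sqrt_divide real_sqrt_abs abs_norm_cancel)
    then show ?thesis by (simp only: v dist Let_def)
  qed
  have "airm_length ?\<gamma> = integral {0..1} (\<lambda>t::real. airm_dist S0 S1)"
    unfolding airm_length_def by (rule integral_cong) (rule speed)
  then show ?thesis by simp
qed

section \<open>The metric in a moving orthogonal basis\<close>

lemma norm_vec_power2: "(norm ((\<chi> i. f i) :: real^'n))\<^sup>2 = (\<Sum>i\<in>UNIV. (f i)\<^sup>2)"
  unfolding power2_norm_eq_inner inner_vec_def by (simp add: power2_eq_square)

lemma norm_matrix_power2_entries: "(norm (X :: real^'n^'m))\<^sup>2 = (\<Sum>i\<in>UNIV. \<Sum>k\<in>UNIV. (X $ i $ k)\<^sup>2)"
  by (simp add: power2_norm_eq_inner inner_vec_def) (simp add: power2_eq_square)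

lemma conj_entry:
  fixes W X :: "real^'n^'n"
  shows "(transpose W ** X ** W) $ i $ k = column i W \<bullet> (X *v column k W)"
proof -
  have "column i W \<bullet> (X *v column k W) = (axis i 1 \<bullet> (transpose W *v (X *v (W *v axis k 1))))"
    unfolding matrix_vector_mult_basis[symmetric]
    by (metis dot_lmul_matrix inner_commute transpose_matrix_vector)
  also have "\<dots> = axis i 1 \<bullet> column k (transpose W ** X ** W)"
    unfolding matrix_vector_mult_basis[symmetric] by (simp only: matrix_vector_mul_assoc matrix_mul_assoc)
  finally show ?thesis by (simp add: inner_axis' column_def)
qed

lemma airm_orthogonal_basis:
  fixes S X :: "real^'n^'n" and w :: "'n \<Rightarrow> real^'n"
  defines "\<delta> \<equiv> \<lambda>i. w i \<bullet> (S *v w i)"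
  assumes orth: "\<And>i k. i \<noteq> k \<Longrightarrow> w i \<bullet> (S *v w k) = 0" and pos: "\<And>i. 0 < \<delta> i"
    and X: "transpose X = X"
  shows "airm S X X = (\<Sum>i\<in>UNIV. \<Sum>k\<in>UNIV. (w i \<bullet> (X *v w k))\<^sup>2 / (\<delta> i * \<delta> k)) / 2"
proof -
  define W where "W = (\<chi> a i. w i $ a / sqrt (\<delta> i))"
  have col: "column i W = w i /\<^sub>R sqrt (\<delta> i)" for i
    by (simp add: W_def column_def vec_eq_iff field_simps)
  have entry: "(transpose W ** Y ** W) $ i $ k = (w i \<bullet> (Y *v w k)) / sqrt (\<delta> i * \<delta> k)" for Y i k
    by (simp add: conj_entry col matrix_vector_mult_scaleR real_sqrt_mult field_simps)
  have "(transpose W ** S ** W) $ i $ k = mat 1 $ i $ k" for i k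
    using pos[of i] orth[of i k] unfolding entry by (auto simp: mat_def \<delta>_def)
  then have "transpose W ** S ** W = mat 1" by (simp add: vec_eq_iff)
  from airm_orthonormal_frame[OF this X]
  have "airm S X X = (\<Sum>i\<in>UNIV. \<Sum>k\<in>UNIV. ((w i \<bullet> (X *v w k)) / sqrt (\<delta> i * \<delta> k))\<^sup>2) / 2"
    unfolding norm_matrix_power2_entries entry .
  also have "\<dots> = (\<Sum>i\<in>UNIV. \<Sum>k\<in>UNIV. (w i \<bullet> (X *v w k))\<^sup>2 / (\<delta> i * \<delta> k)) / 2"
    using pos by (simp add: power_divide less_imp_le)
  finally show ?thesis .
qed

text \<open>The left-hand side keeps only the diagonal terms of the sum in \<open>airm_orthogonal_basis\<close>.\<close>
lemma airm_ge_orthogonal_diagonal: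
  fixes S X :: "real^'n^'n" and w :: "'n \<Rightarrow> real^'n"
  assumes orth: "\<And>i k. i \<noteq> k \<Longrightarrow> w i \<bullet> (S *v w k) = 0" and pos: "\<And>i. 0 < w i \<bullet> (S *v w i)"
    and X: "transpose X = X"
  shows "norm (\<chi> i. (w i \<bullet> (X *v w i)) / (w i \<bullet> (S *v w i))) \<le> sqrt 2 * sqrt (airm S X X)"
proof -
  let ?\<delta> = "\<lambda>i. w i \<bullet> (S *v w i)"
  let ?x = "\<lambda>i k. (w i \<bullet> (X *v w k))\<^sup>2 / (?\<delta> i * ?\<delta> k)"
  have "(norm (\<chi> i. (w i \<bullet> (X *v w i)) / ?\<delta> i))\<^sup>2 = (\<Sum>i\<in>UNIV. ?x i i)"
    unfolding norm_vec_power2 by (simp add: power2_eq_square)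
  also have "\<dots> \<le> (\<Sum>i\<in>UNIV. \<Sum>k\<in>UNIV. ?x i k)"
  proof (rule sum_mono)
    fix i
    have "0 \<le> ?x i k" for k using pos[of i] pos[of k] by simp
    then show "?x i i \<le> (\<Sum>k\<in>UNIV. ?x i k)" by (intro member_le_sum) auto
  qed
  also have "\<dots> = 2 * airm S X X" by (simp add: airm_orthogonal_basis[OF orth pos X])
  finally show ?thesis by (simp add: real_le_rsqrt real_sqrt_mult[symmetric])
qed

section \<open>Gram--Schmidt bases along a path\<close>

text \<open>The recursion needs an ordered index, so the basis is a sequence; the index type of a matrix
  carries no order.\<close>
function gram_schmidt :: "real^'n^'n \<Rightarrow> (nat \<Rightarrow> real^'n) \<Rightarrow> nat \<Rightarrow> real^'n" where
  "gram_schmidt S p k = p k - (\<Sum>l<k.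
     ((gram_schmidt S p l \<bullet> (S *v p k)) / (gram_schmidt S p l \<bullet> (S *v gram_schmidt S p l)))
       *\<^sub>R gram_schmidt S p l)"
  by auto
termination by (relation "Wellfounded.measure (\<lambda>(S, p, k). k)") auto

declare gram_schmidt.simps [simp del]

lemma gram_schmidt_in_span:
  "gram_schmidt S p k - p k \<in> span (p ` {..<k})" "l < k \<Longrightarrow> gram_schmidt S p l \<in> span (p ` {..<k})"
proof -
  have step: "gram_schmidt S p l \<in> span (p ` {..<k})"
    if l: "l < k" and IH: "gram_schmidt S p l - p l \<in> span (p ` {..<l})" for l k
  proof -
    have "span (p ` {..<l}) \<subseteq> span (p ` {..<k})" using l by (intro span_mono image_mono) auto
    moreover have "p l \<in> span (p ` {..<k})" using l by (intro span_base) auto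
    ultimately have "(gram_schmidt S p l - p l) + p l \<in> span (p ` {..<k})"
      using IH by (blast intro: span_add)
    then show ?thesis by simp
  qed
  have diff: "gram_schmidt S p k - p k \<in> span (p ` {..<k})" for k
  proof (induction k rule: less_induct)
    case (less k)
    have "gram_schmidt S p k - p k = - (\<Sum>l<k.
       ((gram_schmidt S p l \<bullet> (S *v p k)) / (gram_schmidt S p l \<bullet> (S *v gram_schmidt S p l)))
         *\<^sub>R gram_schmidt S p l)"
      by (subst gram_schmidt.simps) simp
    also have "\<dots> \<in> span (p ` {..<k})"
      using step less by (intro span_neg span_sum span_scale) auto
    finally show ?case .
  qed
  show "gram_schmidt S p k - p k \<in> span (p ` {..<k})" by (rule diff)
  show "gram_schmidt S p l \<in> span (p ` {..<k})" if "l < k" using step[OF that diff] .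
qed

lemma gram_schmidt_pos:
  assumes S: "S \<in> SPD" and p: "p k \<notin> span (p ` {..<k})"
  shows "0 < gram_schmidt S p k \<bullet> (S *v gram_schmidt S p k)"
proof (rule SPD_D(2)[OF S])
  show "gram_schmidt S p k \<noteq> 0"
  proof
    assume "gram_schmidt S p k = 0"
    then have "- p k \<in> span (p ` {..<k})" using gram_schmidt_in_span(1)[of S p k] by simp
    then show False using p span_neg by fastforce
  qed
qed

lemma gram_schmidt_orthogonal:
  assumes S: "S \<in> SPD" and p: "\<And>k. k < n \<Longrightarrow> p k \<notin> span (p ` {..<k})" and "k < n" "l < k"
  shows "gram_schmidt S p l \<bullet> (S *v gram_schmidt S p k) = 0"
  using assms(3,4)
proof (induction k arbitrary: l rule: less_induct)
  case (less k)
  let ?g = "gram_schmidt S p"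
  let ?c = "\<lambda>m. (?g m \<bullet> (S *v p k)) / (?g m \<bullet> (S *v ?g m))"
  have off: "?g l \<bullet> (S *v ?g m) = 0" if "m < k" "m \<noteq> l" for m
  proof (cases "l < m")
    case True
    then show ?thesis using less that by auto
  next
    case False
    then have "?g m \<bullet> (S *v ?g l) = 0" using less that by auto
    then show ?thesis
      using symmetric_matrix_inner[OF SPD_D(1)[OF S], of "?g l" "?g m"] by (simp add: inner_commute)
  qed
  have "?g l \<bullet> (S *v ?g k) = ?g l \<bullet> (S *v p k) - (\<Sum>m<k. ?c m * (?g l \<bullet> (S *v ?g m)))"
    by (subst gram_schmidt.simps[of S p k])
      (simp add: matrix_vector_mult_diff_distrib inner_diff_right matrix_vector_mult_scaleR
        inner_sum_right linear_sum[OF matrix_vector_mul_linear])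
  also have "(\<Sum>m<k. ?c m * (?g l \<bullet> (S *v ?g m))) = (\<Sum>m<k. if m = l then ?g l \<bullet> (S *v p k) else 0)"
    using off gram_schmidt_pos[OF S p[of l]] less.prems by (intro sum.cong) auto
  also have "\<dots> = ?g l \<bullet> (S *v p k)" using less.prems by simp
  finally show ?case by simp
qed

lemma gram_schmidt_orthogonal_span:
  assumes S: "S \<in> SPD" and p: "\<And>k. k < n \<Longrightarrow> p k \<notin> span (p ` {..<k})" and k: "k < n"
    and v: "v \<in> span (p ` {..<k})"
  shows "v \<bullet> (S *v gram_schmidt S p k) = 0"
  using v
proof (induction rule: span_induct)
  case base
  show ?case by (simp add: subspace_def inner_add_left)
next
  case (step v)
  then obtain l where l: "l < k" and v: "v = p l" by auto
  let ?g = "gram_schmidt S p"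
  have v': "v = ?g l + (\<Sum>m<l. ((?g m \<bullet> (S *v p l)) / (?g m \<bullet> (S *v ?g m))) *\<^sub>R ?g m)"
    unfolding v by (subst gram_schmidt.simps[of S p l]) simp
  have "?g m \<bullet> (S *v ?g k) = 0" if "m \<le> l" for m
    using gram_schmidt_orthogonal[OF S p k, of m] l that by auto
  then show ?case unfolding v' by (simp add: inner_add_left inner_sum_left)
qed

lemma gram_schmidt_of_orthogonal:
  assumes "\<And>l m. l < m \<Longrightarrow> m \<le> k \<Longrightarrow> p l \<bullet> (S *v p m) = 0"
  shows "gram_schmidt S p k = p k"
  using assms
proof (induction k rule: less_induct)
  case (less k)
  have "gram_schmidt S p l = p l" if "l < k" for l using less that by auto
  then show ?case using less.prems by (subst gram_schmidt.simps) simp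
qed

lemma bounded_bilinear_matrix_vector:
  "bounded_bilinear ((*v) :: real^'n^'m \<Rightarrow> real^'n \<Rightarrow> real^'m)"
  unfolding bilinear_conv_bounded_bilinear[symmetric] bilinear_def
  by (auto intro!: linearI simp: matrix_vector_right_distrib matrix_vector_mult_scaleR
      matrix_vector_mult_add_rdistrib scaleR_matrix_vector_assoc)

text \<open>Besides \<open>p k\<close>, whose coefficient is the constant \<open>1\<close>, only earlier vectors enter the recursion.
  Hence the derivative lies in the span of the earlier vectors, to which the \<open>k\<close>-th one is
  \<open>\<gamma> t\<close>-orthogonal.\<close>
lemma gram_schmidt_derivative:
  assumes \<gamma>: "(\<gamma> has_vector_derivative \<gamma>') (at t within T)" and S: "\<gamma> t \<in> SPD"
    and p: "\<And>k. k < n \<Longrightarrow> p k \<notin> span (p ` {..<k})" and "k < n"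
  shows "\<exists>g'. ((\<lambda>s. gram_schmidt (\<gamma> s) p k) has_vector_derivative g') (at t within T)
    \<and> g' \<in> span (p ` {..<k})"
  using \<open>k < n\<close>
proof (induction k rule: less_induct)
  case (less k)
  let ?g = "\<lambda>l s. gram_schmidt (\<gamma> s) p l"
  have "\<forall>l\<in>{..<k}. \<exists>g'. (?g l has_vector_derivative g') (at t within T) \<and> g' \<in> span (p ` {..<l})"
    using less by auto
  then obtain g' where g': "\<And>l. l < k \<Longrightarrow> (?g l has_vector_derivative g' l) (at t within T)"
    and span: "\<And>l. l < k \<Longrightarrow> g' l \<in> span (p ` {..<l})"
    unfolding bchoice_iff by auto
  have span_k: "g' l \<in> span (p ` {..<k})" if "l < k" for l
    using span[OF that] span_mono[OF image_mono, of "{..<l}" "{..<k}" p] that by auto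
  note bb = bounded_bilinear.has_vector_derivative[OF bounded_bilinear_matrix_vector]
    bounded_bilinear.has_vector_derivative[OF bounded_bilinear_inner]
  have "\<exists>c'. ((\<lambda>s. (?g l s \<bullet> (\<gamma> s *v p k)) / (?g l s \<bullet> (\<gamma> s *v ?g l s))) has_real_derivative c')
      (at t within T)" if l: "l < k" for l
  proof -
    have 1: "\<exists>a. ((\<lambda>s. ?g l s \<bullet> (\<gamma> s *v p k)) has_real_derivative a) (at t within T)"
      unfolding has_real_derivative_iff_has_vector_derivative
      by (rule exI, rule bb(2)[OF g'[OF l] bb(1)[OF \<gamma> has_vector_derivative_const]])
    have 2: "\<exists>a. ((\<lambda>s. ?g l s \<bullet> (\<gamma> s *v ?g l s)) has_real_derivative a) (at t within T)"
      unfolding has_real_derivative_iff_has_vector_derivative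
      by (rule exI, rule bb(2)[OF g'[OF l] bb(1)[OF \<gamma> g'[OF l]]])
    have "?g l t \<bullet> (\<gamma> t *v ?g l t) \<noteq> 0"
      using gram_schmidt_pos[OF S p[of l]] l less.prems by simp
    then show ?thesis using 1 2 DERIV_divide by blast
  qed
  then have "\<forall>l\<in>{..<k}. \<exists>c'. ((\<lambda>s. (?g l s \<bullet> (\<gamma> s *v p k)) / (?g l s \<bullet> (\<gamma> s *v ?g l s)))
      has_real_derivative c') (at t within T)" by auto
  then obtain c' where c': "\<And>l. l < k \<Longrightarrow>
      ((\<lambda>s. (?g l s \<bullet> (\<gamma> s *v p k)) / (?g l s \<bullet> (\<gamma> s *v ?g l s))) has_real_derivative c' l)
        (at t within T)"
    unfolding bchoice_iff by auto
  let ?c = "\<lambda>l. (?g l t \<bullet> (\<gamma> t *v p k)) / (?g l t \<bullet> (\<gamma> t *v ?g l t))"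
  let ?g'k = "0 - (\<Sum>l<k. ?c l *\<^sub>R g' l + c' l *\<^sub>R ?g l t)"
  have "(?g k has_vector_derivative ?g'k) (at t within T)"
    unfolding gram_schmidt.simps[of _ p k]
    by (intro has_vector_derivative_diff has_vector_derivative_const has_vector_derivative_sum
        has_vector_derivative_scaleR) (use c' g' in auto)
  moreover have "?g'k \<in> span (p ` {..<k})"
    using span_k gram_schmidt_in_span(2)
    by (intro span_diff span_zero span_sum span_add span_scale) auto
  ultimately show ?case by blast
qed

text \<open>The derivative of the moving vector is \<open>\<gamma> t\<close>-orthogonal to that vector, so only the velocity of
  the path contributes.\<close>
lemma gram_schmidt_length_derivative:
  assumes \<gamma>: "(\<gamma> has_vector_derivative \<gamma>') (at t within T)" and S: "\<gamma> t \<in> SPD"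
    and p: "\<And>k. k < n \<Longrightarrow> p k \<notin> span (p ` {..<k})" and k: "k < n"
  shows "((\<lambda>s. gram_schmidt (\<gamma> s) p k \<bullet> (\<gamma> s *v gram_schmidt (\<gamma> s) p k)) has_real_derivative
     gram_schmidt (\<gamma> t) p k \<bullet> (\<gamma>' *v gram_schmidt (\<gamma> t) p k)) (at t within T)"
proof -
  let ?g = "\<lambda>s. gram_schmidt (\<gamma> s) p k"
  obtain g' where g': "(?g has_vector_derivative g') (at t within T)" and "g' \<in> span (p ` {..<k})"
    using gram_schmidt_derivative[OF \<gamma> S p k] by blast
  then have 0: "g' \<bullet> (\<gamma> t *v ?g t) = 0"
    using gram_schmidt_orthogonal_span[OF S p k] by blast
  then have "?g t \<bullet> (\<gamma> t *v g') = 0"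
    using symmetric_matrix_inner[OF SPD_D(1)[OF S], of "?g t" g'] by (simp add: inner_commute)
  with 0 have "?g t \<bullet> (\<gamma> t *v g' + \<gamma>' *v ?g t) + g' \<bullet> (\<gamma> t *v ?g t) = ?g t \<bullet> (\<gamma>' *v ?g t)"
    by (simp add: inner_add_right)
  moreover have "((\<lambda>s. ?g s \<bullet> (\<gamma> s *v ?g s)) has_vector_derivative
     ?g t \<bullet> (\<gamma> t *v g' + \<gamma>' *v ?g t) + g' \<bullet> (\<gamma> t *v ?g t)) (at t within T)"
    by (intro bounded_bilinear.has_vector_derivative[OF bounded_bilinear_matrix_vector]
        bounded_bilinear.has_vector_derivative[OF bounded_bilinear_inner] g' \<gamma>)
  ultimately show ?thesis by (simp add: has_real_derivative_iff_has_vector_derivative)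
qed

section \<open>Geodesics minimise length\<close>

lemma symmetric_derivative:
  fixes \<gamma> :: "real \<Rightarrow> real^'n^'n"
  assumes \<gamma>: "(\<gamma> has_vector_derivative \<gamma>') (at t within {0..1})" and t: "t \<in> {0..1}"
    and sym: "\<And>s. s \<in> {0..1} \<Longrightarrow> transpose (\<gamma> s) = \<gamma> s"
  shows "transpose \<gamma>' = \<gamma>'"
proof -
  have entry: "((\<lambda>s. \<gamma> s $ i $ k) has_vector_derivative \<gamma>' $ i $ k) (at t within {0..1})" for i k
    by (intro bounded_linear.has_vector_derivative[OF bounded_linear_vec_nth] \<gamma>)
  have "\<gamma>' $ k $ i = \<gamma>' $ i $ k" for i k
  proof (rule vector_derivative_unique_within_closed_interval[of 0 1 t])
    have "\<gamma> s $ i $ k = \<gamma> s $ k $ i" if "s \<in> {0..1}" for s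
      using arg_cong[OF sym[OF that], of "\<lambda>A. A $ k $ i"] by (simp add: transpose_def)
    then show "((\<lambda>s. \<gamma> s $ k $ i) has_vector_derivative \<gamma>' $ i $ k) (at t within cbox 0 1)"
      using has_vector_derivative_transform_within[OF entry[of i k] zero_less_one t] by simp
  qed (use t entry[of k i] in auto)
  then show ?thesis by (simp add: vec_eq_iff transpose_def)
qed

text \<open>Take a basis \<open>p\<close> for which the end points are the identity and a diagonal matrix \<open>d\<close>. Along
  the path, orthogonalise \<open>p\<close> with respect to \<open>\<gamma> t\<close>, and let \<open>\<delta>\<close> be the squared lengths of the
  resulting vectors. The curve of the logarithms of \<open>\<delta>\<close> goes from \<open>0\<close> to \<open>ln d\<close> in Euclidean space,
  and its speed is that of the diagonal part of \<open>\<gamma>'\<close> in an orthonormal basis, hence at most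
  \<open>sqrt 2\<close> times the speed of \<open>\<gamma>\<close>.\<close>
theorem airm_dist_le_length:
  fixes \<gamma> :: "real \<Rightarrow> real^'n^'n"
  assumes smooth: "smooth_path \<gamma>" and SPD: "\<gamma> ` {0..1} \<subseteq> SPD"
  shows "airm_dist (\<gamma> 0) (\<gamma> 1) \<le> airm_length \<gamma>"
proof -
  have S: "\<gamma> t \<in> SPD" if "t \<in> {0..1}" for t using SPD that by auto
  obtain D where D0: "\<And>t. t \<in> {0..1} \<Longrightarrow> D 0 t = \<gamma> t"
    and D: "\<And>n t. t \<in> {0..1} \<Longrightarrow> (D n has_vector_derivative D (Suc n) t) (at t within {0..1})"
    using smooth unfolding smooth_path_def by metis
  define X where "X = D 1"
  have \<gamma>: "(\<gamma> has_vector_derivative X t) (at t within {0..1})" if "t \<in> {0..1}" for t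
    using has_vector_derivative_transform_within[OF D[OF that, of 0] zero_less_one that] D0
    by (simp add: X_def)
  have X: "transpose (X t) = X t" if "t \<in> {0..1}" for t
    using symmetric_derivative[OF \<gamma>[OF that] that] SPD_D(1)[OF S] by blast
  have contX: "continuous_on {0..1} X"
    unfolding continuous_on_eq_continuous_within X_def
    using D has_vector_derivative_continuous by blast
  have S01: "\<gamma> 0 \<in> SPD" "\<gamma> 1 \<in> SPD" using S by auto
  obtain R :: "real^'n^'n" and d where R: "invertible R" and d: "\<And>i. 0 < d i"
    and S0: "\<gamma> 0 = R ** transpose R" and S1: "\<gamma> 1 = R ** diag_mat d ** transpose R"
    and dist: "airm_dist (\<gamma> 0) (\<gamma> 1) = norm (\<chi> i. ln (d i)) / sqrt 2"
    using SPD_pair_normal_form[OF S01] by metis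
  obtain R' where R': "R' ** R = mat 1" using R by (auto simp: invertible_def)
  have tR': "transpose R ** transpose R' = mat 1"
    by (simp add: matrix_transpose_mul[symmetric] R')
  define q where "q i = column i (transpose R')" for i
  have q: "q i \<bullet> ((R ** diag_mat a ** transpose R) *v q k) = diag_mat a $ i $ k" for a i k
  proof -
    have "q i \<bullet> ((R ** diag_mat a ** transpose R) *v q k)
        = ((R' ** R) ** diag_mat a ** (transpose R ** transpose R')) $ i $ k"
      unfolding q_def conj_entry[symmetric] by (simp only: matrix_mul_assoc transpose_transpose)
    then show ?thesis by (simp add: R' tR')
  qed
  have q0: "q i \<bullet> (\<gamma> 0 *v q k) = (if i = k then 1 else 0)" for i k
    using q[of i "\<lambda>_. 1" k] by (simp add: diag_mat_one S0) (simp add: mat_def)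
  have q1: "q i \<bullet> (\<gamma> 1 *v q k) = (if i = k then d i else 0)" for i k
    using q[of i d k] by (simp add: S1 diag_mat_def)
  define n where "n = CARD('n)"
  have "\<exists>e. bij_betw e (UNIV :: 'n set) {..<n}"
    by (rule finite_same_card_bij) (simp_all add: n_def)
  then obtain e where e: "bij_betw e (UNIV :: 'n set) {..<n}" by blast
  have e_lt: "e i < n" for i using e by (auto simp: bij_betw_def)
  have e_inj: "inj e" using e by (rule bij_betw_imp_inj_on)
  define p where "p k = q (inv e k)" for k
  have inv_e: "inv e k = inv e l \<longleftrightarrow> k = l" if "k < n" "l < n" for k l
  proof -
    have "k \<in> range e" "l \<in> range e" using that e by (auto simp: bij_betw_def)
    then show ?thesis by (metis f_inv_into_f)
  qed
  have pe: "p (e i) = q i" for i by (simp add: p_def e_inj)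
  have orth0: "p l \<bullet> (\<gamma> 0 *v p m) = 0" and orth1: "p l \<bullet> (\<gamma> 1 *v p m) = 0"
    if "l < m" "m < n" for l m
    using that inv_e[of l m] by (simp_all add: p_def q0 q1)
  have indep: "p k \<notin> span (p ` {..<k})" if k: "k < n" for k
  proof
    have orth_span: "x \<bullet> (\<gamma> 0 *v p k) = 0" if "x \<in> span (p ` {..<k})" for x
      using that
    proof (induction rule: span_induct)
      case base
      show ?case by (simp add: subspace_def inner_add_left)
    qed (use orth0 k in auto)
    assume "p k \<in> span (p ` {..<k})"
    then have "p k \<bullet> (\<gamma> 0 *v p k) = 0" by (rule orth_span)
    then show False by (simp add: p_def q0)
  qed
  define w where "w t i = gram_schmidt (\<gamma> t) p (e i)" for t i
  define \<delta> where "\<delta> t i = w t i \<bullet> (\<gamma> t *v w t i)" for t i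
  have pos: "0 < \<delta> t i" if "t \<in> {0..1}" for t i
    unfolding \<delta>_def w_def by (rule gram_schmidt_pos[OF S[OF that] indep[OF e_lt]])
  have orth: "w t i \<bullet> (\<gamma> t *v w t k) = 0" if t: "t \<in> {0..1}" and "i \<noteq> k" for t i k
  proof -
    have "e i \<noteq> e k" using \<open>i \<noteq> k\<close> e_inj by (auto simp: inj_def)
    then consider "e i < e k" | "e k < e i" by linarith
    then show ?thesis
    proof cases
      case 1
      then show ?thesis
        unfolding w_def using gram_schmidt_orthogonal[OF S[OF t] indep] e_lt by blast
    next
      case 2
      then have "w t k \<bullet> (\<gamma> t *v w t i) = 0"
        unfolding w_def using gram_schmidt_orthogonal[OF S[OF t] indep] e_lt by blast
      then show ?thesis
        using symmetric_matrix_inner[OF SPD_D(1)[OF S[OF t]], of "w t i" "w t k"]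
        by (simp add: inner_commute)
    qed
  qed
  have w0: "w 0 i = q i" and w1: "w 1 i = q i" for i
  proof -
    have "gram_schmidt (\<gamma> s) p (e i) = p (e i)" if "s = 0 \<or> s = 1" for s
      using that orth0 orth1 e_lt[of i] by (intro gram_schmidt_of_orthogonal) auto
    then show "w 0 i = q i" "w 1 i = q i" by (simp_all add: w_def pe)
  qed
  define f where "f t = (\<chi> i. ln (\<delta> t i))" for t
  define f' where "f' t = (\<chi> i. (w t i \<bullet> (X t *v w t i)) / \<delta> t i)" for t
  have f': "(f has_vector_derivative f' t) (at t within {0..1})" if t: "t \<in> {0..1}" for t
  proof (rule has_vector_derivative_vec)
    fix i
    have "((\<lambda>t. \<delta> t i) has_real_derivative w t i \<bullet> (X t *v w t i)) (at t within {0..1})"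
      unfolding \<delta>_def w_def
      by (rule gram_schmidt_length_derivative[OF \<gamma>[OF t] S[OF t] indep e_lt])
    from DERIV_chain2[OF DERIV_ln_divide[OF pos[OF t, of i]] this]
    show "((\<lambda>t. f t $ i) has_vector_derivative f' t $ i) (at t within {0..1})"
      by (simp add: f_def f'_def has_real_derivative_iff_has_vector_derivative)
  qed
  have FTC: "(f' has_integral f 1 - f 0) {0..1}"
    by (rule fundamental_theorem_of_calculus) (use f' in auto)
  have f01: "f 1 - f 0 = (\<chi> i. ln (d i))"
    by (simp add: f_def \<delta>_def w0 w1 q0 q1 vec_eq_iff)
  define v where "v t = sqrt (airm (\<gamma> t) (X t) (X t))" for t
  have contw: "continuous_on {0..1} (\<lambda>t. w t i)" for i
    unfolding continuous_on_eq_continuous_within w_def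
    using gram_schmidt_derivative[OF \<gamma> S indep e_lt] has_vector_derivative_continuous by blast
  have cont\<gamma>: "continuous_on {0..1} \<gamma>"
    unfolding continuous_on_eq_continuous_within
    using \<gamma> has_vector_derivative_continuous by blast
  have \<delta>_nz: "\<delta> t i \<noteq> 0" if "t \<in> {0..1}" for t i
    using pos[OF that, of i] by simp
  note cont_mv = bounded_bilinear.continuous_on[OF bounded_bilinear_matrix_vector]
  have "continuous_on {0..1} (\<lambda>t. sqrt ((\<Sum>i\<in>UNIV. \<Sum>k\<in>UNIV.
      (w t i \<bullet> (X t *v w t k))\<^sup>2 / (\<delta> t i * \<delta> t k)) / 2))"
    unfolding \<delta>_def
    by (intro continuous_intros cont_mv contw cont\<gamma> contX)
      (use \<delta>_nz in \<open>auto simp: \<delta>_def[symmetric]\<close>)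
  then have contv: "continuous_on {0..1} v"
    by (rule continuous_on_eq)
      (use airm_orthogonal_basis[OF orth _ X] pos in \<open>simp add: v_def \<delta>_def\<close>)
  have "norm (integral {0..1} f') \<le> integral {0..1} (\<lambda>t. sqrt 2 * v t)"
  proof (rule Henstock_Kurzweil_Integration.integral_norm_bound_integral)
    show "f' integrable_on {0..1}" using FTC by blast
    show "(\<lambda>t. sqrt 2 * v t) integrable_on {0..1}"
      by (intro integrable_continuous_real continuous_intros contv)
    show "norm (f' t) \<le> sqrt 2 * v t" if t: "t \<in> {0..1}" for t
      unfolding f'_def v_def \<delta>_def
      using airm_ge_orthogonal_diagonal[OF orth[OF t] _ X[OF t]] pos[OF t] by (simp add: \<delta>_def)
  qed
  moreover have "integral {0..1} f' = (\<chi> i. ln (d i))"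
    using FTC f01 by (simp add: integral_unique)
  moreover have "airm_length \<gamma> = integral {0..1} v"
    unfolding airm_length_def
  proof (rule integral_cong)
    fix t :: real assume t: "t \<in> {0..1}"
    have "vector_derivative \<gamma> (at t within {0..1}) = X t"
      using t \<gamma>[OF t] by (intro vector_derivative_within_closed_interval) auto
    then show "(let v = vector_derivative \<gamma> (at t within {0..1}) in sqrt (airm (\<gamma> t) v v)) = v t"
      by (simp add: v_def Let_def)
  qed
  ultimately show ?thesis by (simp add: dist field_simps)
qed

corollary intrinsic_dist_eq_airm_dist:
  fixes S0 S1 :: "real^'n^'n"
  assumes S: "S0 \<in> SPD" "S1 \<in> SPD" and N: "airm_geodesic S0 S1 ` {0..1} \<subseteq> N"
  shows "intrinsic_dist N S0 S1 = ereal (airm_dist S0 S1)"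
  unfolding intrinsic_dist_def
proof (rule antisym)
  show "(INF \<gamma> \<in> {\<gamma>. smooth_path \<gamma> \<and> \<gamma> ` {0..1} \<subseteq> SPD \<inter> N \<and> \<gamma> 0 = S0 \<and> \<gamma> 1 = S1}.
      ereal (airm_length \<gamma>)) \<le> ereal (airm_dist S0 S1)"
    using N airm_geodesic_smooth[OF S] airm_geodesic_SPD[OF S] airm_geodesic_endpoints[OF S]
      airm_geodesic_length[OF S]
    by (intro INF_lower2[of "airm_geodesic S0 S1"]) auto
  show "ereal (airm_dist S0 S1) \<le>
    (INF \<gamma> \<in> {\<gamma>. smooth_path \<gamma> \<and> \<gamma> ` {0..1} \<subseteq> SPD \<inter> N \<and> \<gamma> 0 = S0 \<and> \<gamma> 1 = S1}.
      ereal (airm_length \<gamma>))"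
  proof (rule INF_greatest)
    fix \<gamma> assume "\<gamma> \<in> {\<gamma>. smooth_path \<gamma> \<and> \<gamma> ` {0..1} \<subseteq> SPD \<inter> N \<and> \<gamma> 0 = S0 \<and> \<gamma> 1 = S1}"
    then show "ereal (airm_dist S0 S1) \<le> ereal (airm_length \<gamma>)"
      using airm_dist_le_length[of \<gamma>] by auto
  qed
qed

section \<open>Exponential integrability and moments\<close>

lemma densitiesD:
  assumes "p \<in> densities M"
  shows "p \<in> borel_measurable M" "AE x in M. 0 < p x" "integrable M p" "(\<integral>x. p x \<partial>M) = 1"
  using assms by (auto simp: densities_def)

lemma nn_expect_finite_iff:
  assumes p: "p \<in> densities M" and f: "f \<in> borel_measurable M" "\<And>x. 0 \<le> f x"
  shows "nn_expect M p f < \<infinity> \<longleftrightarrow> integrable M (\<lambda>x. f x * p x)"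
proof -
  have "nn_expect M p f = (\<integral>\<^sup>+x. ennreal (norm (f x * p x)) \<partial>M)"
    unfolding nn_expect_def
    using densitiesD(2)[OF p] by (intro nn_integral_cong_AE) (auto simp: f(2))
  moreover have "(\<lambda>x. f x * p x) \<in> borel_measurable M"
    using f densitiesD(1)[OF p] by measurable
  ultimately show ?thesis by (simp add: integrable_iff_bounded)
qed

lemma nn_expect_eq_expect:
  assumes p: "p \<in> densities M" and f: "integrable M (\<lambda>x. f x * p x)" "\<And>x. 0 \<le> f x"
  shows "nn_expect M p f = ennreal (expect M p f)"
  unfolding nn_expect_def expect_def
  using densitiesD(2)[OF p] by (intro nn_integral_eq_integral f(1)) (auto simp: f(2))

lemma integrable_weight_bound:
  fixes f g p :: "'a \<Rightarrow> real"
  assumes p: "p \<in> densities M" and f: "f \<in> borel_measurable M"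
    and g: "integrable M (\<lambda>x. g x * p x)" and le: "\<And>x. \<bar>f x\<bar> \<le> g x"
  shows "integrable M (\<lambda>x. f x * p x)"
proof (rule Bochner_Integration.integrable_bound[OF g])
  show "(\<lambda>x. f x * p x) \<in> borel_measurable M" using f densitiesD(1)[OF p] by measurable
  show "AE x in M. norm (f x * p x) \<le> norm (g x * p x)"
    using densitiesD(2)[OF p]
  proof eventually_elim
    case (elim x)
    have "\<bar>f x\<bar> \<le> \<bar>g x\<bar>" using le[of x] by linarith
    then show ?case using elim by (simp add: abs_mult mult_right_mono)
  qed
qed

lemma cosh_le_of_abs_le: "\<bar>x\<bar> \<le> \<bar>y\<bar> \<Longrightarrow> cosh x \<le> cosh (y :: real)"
  using cosh_real_nonneg_le_iff[of "\<bar>x\<bar>" "\<bar>y\<bar>"] by simp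

lemma abs_le_cosh: "\<bar>y :: real\<bar> \<le> 2 * cosh y"
proof -
  have "1 + \<bar>y\<bar> \<le> exp \<bar>y\<bar>" by (rule exp_ge_add_one_self)
  also have "\<dots> \<le> exp y + exp (- y)" by (cases "0 \<le> y") (auto simp: abs_if)
  finally show ?thesis by (simp add: cosh_def)
qed

text \<open>Convexity of \<open>exp\<close> between \<open>0\<close> and \<open>y\<close>, and between \<open>0\<close> and \<open>- y\<close>.\<close>
lemma cosh_scale_convex:
  fixes y l :: real
  assumes "0 \<le> l" "l \<le> 1"
  shows "cosh (l * y) - 1 \<le> l * (cosh y - 1)"
proof -
  have "exp (l * z) \<le> (1 - l) + l * exp z" for z :: real
    using convex_onD[OF exp_convex, of l 0 z] assms by simp
  from this[of y] this[of "- y"] show ?thesis by (simp add: cosh_def algebra_simps)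
qed

lemma Bspace_iff:
  assumes p: "p \<in> densities M"
  shows "u \<in> Bspace M p \<longleftrightarrow> u \<in> borel_measurable M \<and>
    (\<exists>\<alpha>>0. integrable M (\<lambda>x. cosh (\<alpha> * u x) * p x)) \<and> expect M p u = 0"
proof -
  have "nn_expect M p (\<lambda>x. cosh (\<alpha> * u x) - 1) < \<infinity> \<longleftrightarrow> integrable M (\<lambda>x. cosh (\<alpha> * u x) * p x)"
    if u: "u \<in> borel_measurable M" for \<alpha>
  proof -
    have meas: "(\<lambda>x. cosh (\<alpha> * u x) - 1) \<in> borel_measurable M"
      using u unfolding cosh_def by measurable
    have "nn_expect M p (\<lambda>x. cosh (\<alpha> * u x) - 1) < \<infinity>
        \<longleftrightarrow> integrable M (\<lambda>x. (cosh (\<alpha> * u x) - 1) * p x)"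
      by (rule nn_expect_finite_iff[OF p meas]) (simp add: cosh_real_ge_1)
    also have "\<dots> \<longleftrightarrow> integrable M (\<lambda>x. cosh (\<alpha> * u x) * p x)"
    proof
      assume "integrable M (\<lambda>x. (cosh (\<alpha> * u x) - 1) * p x)"
      from Bochner_Integration.integrable_add[OF this densitiesD(3)[OF p]]
      show "integrable M (\<lambda>x. cosh (\<alpha> * u x) * p x)" by (simp add: algebra_simps)
    next
      assume "integrable M (\<lambda>x. cosh (\<alpha> * u x) * p x)"
      from Bochner_Integration.integrable_diff[OF this densitiesD(3)[OF p]]
      show "integrable M (\<lambda>x. (cosh (\<alpha> * u x) - 1) * p x)" by (simp add: algebra_simps)
    qed
    finally show ?thesis .
  qed
  then show ?thesis unfolding Bspace_def by auto
qed

lemma Bspace_measurable: "u \<in> Bspace M p \<Longrightarrow> u \<in> borel_measurable M"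
  by (simp add: Bspace_def)

lemma Bspace_integrable:
  assumes p: "p \<in> densities M" and u: "u \<in> Bspace M p"
  shows "integrable M (\<lambda>x. u x * p x)"
proof -
  obtain \<alpha> where \<alpha>: "\<alpha> > 0" "integrable M (\<lambda>x. cosh (\<alpha> * u x) * p x)"
    using u Bspace_iff[OF p] by auto
  have "\<bar>u x\<bar> \<le> 2 / \<alpha> * cosh (\<alpha> * u x)" for x
    using abs_le_cosh[of "\<alpha> * u x"] \<alpha>(1) by (simp add: abs_mult field_simps)
  moreover have "integrable M (\<lambda>x. (2 / \<alpha> * cosh (\<alpha> * u x)) * p x)"
    using integrable_mult_right[OF \<alpha>(2), of "2 / \<alpha>"] by (simp add: mult.assoc)
  ultimately show ?thesis
    by (intro integrable_weight_bound[OF p Bspace_measurable[OF u],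
          where g = "\<lambda>x. 2 / \<alpha> * cosh (\<alpha> * u x)"])
qed

lemma Bspace_scale:
  assumes p: "p \<in> densities M" and u: "u \<in> Bspace M p"
  shows "(\<lambda>x. c * u x) \<in> Bspace M p"
proof -
  obtain \<alpha> where \<alpha>: "\<alpha> > 0" "integrable M (\<lambda>x. cosh (\<alpha> * u x) * p x)"
    and u0: "expect M p u = 0" and um: "u \<in> borel_measurable M"
    using u Bspace_iff[OF p] by auto
  define \<beta> where "\<beta> = \<alpha> / (\<bar>c\<bar> + 1)"
  have "\<beta> > 0" using \<alpha>(1) by (simp add: \<beta>_def)
  have "\<beta> * \<bar>c\<bar> \<le> \<alpha>" using \<alpha>(1) by (simp add: \<beta>_def field_simps)
  then have "\<beta> * \<bar>c\<bar> * \<bar>u x\<bar> \<le> \<alpha> * \<bar>u x\<bar>" for x by (rule mult_right_mono) simp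
  then have "cosh (\<beta> * (c * u x)) \<le> cosh (\<alpha> * u x)" for x
    using \<open>\<beta> > 0\<close> \<alpha>(1) by (intro cosh_le_of_abs_le) (simp add: abs_mult mult.assoc)
  then have bound: "\<bar>cosh (\<beta> * (c * u x))\<bar> \<le> cosh (\<alpha> * u x)" for x
    by (simp add: abs_of_nonneg cosh_real_nonneg)
  have "(\<lambda>x. cosh (\<beta> * (c * u x))) \<in> borel_measurable M"
    using um unfolding cosh_def by measurable
  from integrable_weight_bound[OF p this \<alpha>(2) bound]
  have "integrable M (\<lambda>x. cosh (\<beta> * (c * u x)) * p x)" .
  moreover have "expect M p (\<lambda>x. c * u x) = 0" using u0 by (simp add: expect_def mult.assoc)
  ultimately show ?thesis using um \<open>\<beta> > 0\<close> by (auto simp: Bspace_iff[OF p])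
qed

lemma Bspace_add:
  assumes p: "p \<in> densities M" and u: "u \<in> Bspace M p" and v: "v \<in> Bspace M p"
  shows "(\<lambda>x. u x + v x) \<in> Bspace M p"
proof -
  obtain \<alpha> where \<alpha>: "\<alpha> > 0" "integrable M (\<lambda>x. cosh (\<alpha> * u x) * p x)"
    and u0: "expect M p u = 0" and um: "u \<in> borel_measurable M"
    using u Bspace_iff[OF p] by auto
  obtain \<beta> where \<beta>: "\<beta> > 0" "integrable M (\<lambda>x. cosh (\<beta> * v x) * p x)"
    and v0: "expect M p v = 0" and vm: "v \<in> borel_measurable M"
    using v Bspace_iff[OF p] by auto
  define \<gamma> where "\<gamma> = min \<alpha> \<beta> / 2"
  have \<gamma>: "\<gamma> > 0" using \<alpha>(1) \<beta>(1) by (simp add: \<gamma>_def)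
  have bound: "\<bar>cosh (\<gamma> * (u x + v x))\<bar> \<le> cosh (\<alpha> * u x) + cosh (\<beta> * v x)" for x
  proof -
    have "\<bar>\<gamma> * (u x + v x)\<bar> \<le> \<gamma> * \<bar>u x\<bar> + \<gamma> * \<bar>v x\<bar>"
      using \<gamma> abs_triangle_ineq[of "u x" "v x"] by (simp add: abs_mult distrib_left[symmetric])
    also have "\<dots> \<le> (\<alpha> / 2) * \<bar>u x\<bar> + (\<beta> / 2) * \<bar>v x\<bar>"
      by (intro add_mono mult_right_mono) (auto simp: \<gamma>_def)
    finally have "\<bar>\<gamma> * (u x + v x)\<bar> \<le> \<bar>\<alpha> * u x\<bar> \<or> \<bar>\<gamma> * (u x + v x)\<bar> \<le> \<bar>\<beta> * v x\<bar>"
      using \<alpha>(1) \<beta>(1) by (auto simp: abs_mult)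
    then have "cosh (\<gamma> * (u x + v x)) \<le> cosh (\<alpha> * u x) \<or> cosh (\<gamma> * (u x + v x)) \<le> cosh (\<beta> * v x)"
      using cosh_le_of_abs_le by blast
    then show ?thesis
      using cosh_real_ge_1[of "\<alpha> * u x"] cosh_real_ge_1[of "\<beta> * v x"]
        cosh_real_ge_1[of "\<gamma> * (u x + v x)"] by linarith
  qed
  have sum: "integrable M (\<lambda>x. (cosh (\<alpha> * u x) + cosh (\<beta> * v x)) * p x)"
    using Bochner_Integration.integrable_add[OF \<alpha>(2) \<beta>(2)] by (simp add: distrib_right)
  have "(\<lambda>x. cosh (\<gamma> * (u x + v x))) \<in> borel_measurable M"
    using um vm unfolding cosh_def by measurable
  from integrable_weight_bound[OF p this sum bound]
  have "integrable M (\<lambda>x. cosh (\<gamma> * (u x + v x)) * p x)" .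
  moreover have "expect M p (\<lambda>x. u x + v x) = 0"
    using u0 v0 Bspace_integrable[OF p u] Bspace_integrable[OF p v]
    by (simp add: expect_def distrib_right)
  ultimately show ?thesis using um vm \<gamma> by (auto simp: Bspace_iff[OF p])
qed

text \<open>Convexity of \<open>cosh\<close> turns a finite expectation at some scale into an expectation of at most \<open>1\<close>
  at a smaller scale, which bounds the norm; the norm then shrinks with the factor.\<close>
lemma Bnorm_scale_small:
  assumes p: "p \<in> densities M" and u: "u \<in> Bspace M p" and \<epsilon>: "\<epsilon> > 0"
  shows "\<exists>s>0. Bnorm M p (\<lambda>x. s * u x) < \<epsilon>"
proof -
  obtain \<alpha> where \<alpha>: "\<alpha> > 0" "integrable M (\<lambda>x. cosh (\<alpha> * u x) * p x)"
    and um: "u \<in> borel_measurable M"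
    using u Bspace_iff[OF p] by auto
  have int: "integrable M (\<lambda>x. (cosh (\<alpha> * u x) - 1) * p x)"
    using Bochner_Integration.integrable_diff[OF \<alpha>(2) densitiesD(3)[OF p]]
    by (simp add: algebra_simps)
  define C where "C = expect M p (\<lambda>x. cosh (\<alpha> * u x) - 1)"
  have "0 \<le> C"
    unfolding C_def expect_def using densitiesD(2)[OF p]
    by (intro integral_nonneg_AE) (auto simp: cosh_real_ge_1)
  define l where "l = 1 / (1 + C)"
  have l: "0 < l" "l \<le> 1" "l * C \<le> 1" using \<open>0 \<le> C\<close> by (auto simp: l_def)
  have le: "cosh (l * (\<alpha> * u x)) - 1 \<le> l * (cosh (\<alpha> * u x) - 1)" for x
    using l by (intro cosh_scale_convex) auto
  have int_l: "integrable M (\<lambda>x. (l * (cosh (\<alpha> * u x) - 1)) * p x)"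
    using integrable_mult_right[OF int, of l] by (simp add: mult.assoc)
  have "nn_expect M p (\<lambda>x. cosh (l * (\<alpha> * u x)) - 1) \<le> nn_expect M p (\<lambda>x. l * (cosh (\<alpha> * u x) - 1))"
    unfolding nn_expect_def
  proof (rule nn_integral_mono_AE)
    show "AE x in M. ennreal ((cosh (l * (\<alpha> * u x)) - 1) * p x)
        \<le> ennreal (l * (cosh (\<alpha> * u x) - 1) * p x)"
      using densitiesD(2)[OF p]
      by eventually_elim (intro ennreal_leI mult_right_mono le, simp)
  qed
  also have "\<dots> = ennreal (expect M p (\<lambda>x. l * (cosh (\<alpha> * u x) - 1)))"
    using l by (intro nn_expect_eq_expect[OF p int_l]) (simp add: cosh_real_ge_1)
  also have "expect M p (\<lambda>x. l * (cosh (\<alpha> * u x) - 1)) = l * C"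
    by (simp add: C_def expect_def mult.assoc)
  finally have small: "nn_expect M p (\<lambda>x. cosh (l * (\<alpha> * u x)) - 1) \<le> 1"
    using l(3) by (meson ennreal_le_1 order_trans)
  define s where "s = \<epsilon> / 2 * (l * \<alpha>)"
  have "s > 0" using \<epsilon> l \<alpha>(1) by (simp add: s_def)
  have "s * u x / (\<epsilon> / 2) = l * (\<alpha> * u x)" for x using \<epsilon> by (simp add: s_def)
  then have "\<epsilon> / 2 \<in> {r. 0 < r \<and> nn_expect M p (\<lambda>x. cosh (s * u x / r) - 1) \<le> 1}"
    using \<epsilon> small by simp
  then have "Bnorm M p (\<lambda>x. s * u x) \<le> \<epsilon> / 2"
    unfolding Bnorm_def by (intro cInf_lower) (auto intro!: bdd_belowI[of _ 0])
  then have "Bnorm M p (\<lambda>x. s * u x) < \<epsilon>" using \<epsilon> by simp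
  then show ?thesis using \<open>s > 0\<close> by blast
qed

text \<open>The interior is taken in the Banach space, so a small multiple of any element \<open>w\<close> can be added to
  the exponent without losing integrability.\<close>
lemma params_tilt:
  assumes p: "p \<in> densities M" and \<theta>: "\<theta> \<in> params M p u" and w: "w \<in> Bspace M p"
  shows "\<exists>s>0. integrable M (\<lambda>x. exp (lin_comb u \<theta> x + s * w x) * p x)"
proof -
  let ?l = "lin_comb u \<theta>"
  obtain \<epsilon> where l: "?l \<in> Bspace M p" and \<epsilon>: "\<epsilon> > 0"
    and dom: "\<And>v. v \<in> Bspace M p \<Longrightarrow> Bnorm M p (\<lambda>x. v x - ?l x) < \<epsilon> \<Longrightarrow> v \<in> cumulant_dom M p"
    using \<theta> by (auto simp: params_def cumulant_dom_interior_def)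
  obtain s where s: "s > 0" "Bnorm M p (\<lambda>x. s * w x) < \<epsilon>"
    using Bnorm_scale_small[OF p w \<epsilon>] by blast
  let ?v = "\<lambda>x. ?l x + s * w x"
  have v: "?v \<in> Bspace M p" by (intro Bspace_add Bspace_scale p l w)
  then have "?v \<in> cumulant_dom M p" using s(2) by (intro dom) simp_all
  then have "nn_expect M p (\<lambda>x. exp (?v x)) < \<infinity>"
    by (auto simp: cumulant_dom_def cumulant_def Let_def less_top split: if_splits)
  moreover have "(\<lambda>x. exp (?v x)) \<in> borel_measurable M" using Bspace_measurable[OF v] by measurable
  ultimately have "integrable M (\<lambda>x. exp (?v x) * p x)"
    using nn_expect_finite_iff[OF p, of "\<lambda>x. exp (?v x)"] by simp
  then show ?thesis using s(1) by blast
qed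

lemma params_Bspace: "\<theta> \<in> params M p u \<Longrightarrow> lin_comb u \<theta> \<in> Bspace M p"
  unfolding params_def cumulant_dom_interior_def by blast

lemma params_exp_integrable:
  assumes p: "p \<in> densities M" and \<theta>: "\<theta> \<in> params M p u"
  shows "integrable M (\<lambda>x. exp (lin_comb u \<theta> x) * p x)"
proof -
  have "(\<lambda>x. 0 * lin_comb u \<theta> x) \<in> Bspace M p"
    by (rule Bspace_scale[OF p params_Bspace[OF \<theta>]])
  from params_tilt[OF p \<theta> this] show ?thesis by simp
qed

lemma expect_exp_pos:
  assumes p: "p \<in> densities M" and f: "integrable M (\<lambda>x. exp (f x) * p x)"
  shows "0 < expect M p (\<lambda>x. exp (f x))"
proof (rule ccontr)
  have nonneg: "AE x in M. 0 \<le> exp (f x) * p x"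
    using densitiesD(2)[OF p] by eventually_elim simp
  assume "\<not> 0 < expect M p (\<lambda>x. exp (f x))"
  moreover have "0 \<le> expect M p (\<lambda>x. exp (f x))"
    unfolding expect_def by (rule integral_nonneg_AE[OF nonneg])
  ultimately have "AE x in M. exp (f x) * p x = 0"
    using integral_nonneg_eq_0_iff_AE[OF f nonneg] by (simp add: expect_def)
  then have "AE x in M. p x = 0" by simp
  then have "(\<integral>x. p x \<partial>M) = 0" by (rule integral_eq_zero_AE)
  then show False using densitiesD(4)[OF p] by simp
qed

lemma exp_density_eq:
  assumes p: "p \<in> densities M" and \<theta>: "\<theta> \<in> params M p u"
  shows "exp_density M p u \<theta> x = exp (lin_comb u \<theta> x) * p x / expect M p (\<lambda>x. exp (lin_comb u \<theta> x))"
proof -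
  note int = params_exp_integrable[OF p \<theta>]
  have "log_partition M p u \<theta> = ln (expect M p (\<lambda>x. exp (lin_comb u \<theta> x)))"
    using nn_expect_eq_expect[OF p int] expect_exp_pos[OF p int]
    by (simp add: log_partition_def cumulant_def Let_def)
  then show ?thesis using expect_exp_pos[OF p int] by (simp add: exp_density_def exp_diff)
qed

lemma exp_density_densities:
  assumes p: "p \<in> densities M" and \<theta>: "\<theta> \<in> params M p u"
  shows "exp_density M p u \<theta> \<in> densities M"
proof -
  note int = params_exp_integrable[OF p \<theta>]
  note pos = expect_exp_pos[OF p int]
  have eq: "exp_density M p u \<theta> = (\<lambda>x. exp (lin_comb u \<theta> x) * p x / expect M p (\<lambda>x. exp (lin_comb u \<theta> x)))"
    using exp_density_eq[OF p \<theta>] by blast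
  have "integrable M (exp_density M p u \<theta>)" unfolding eq using int by simp
  moreover have "(\<integral>x. exp_density M p u \<theta> x \<partial>M) = 1"
    unfolding eq using pos by (simp add: expect_def)
  moreover have "AE x in M. 0 < exp_density M p u \<theta> x"
    using densitiesD(2)[OF p] unfolding eq by eventually_elim (simp add: pos)
  ultimately show ?thesis unfolding densities_def by auto
qed

text \<open>The square of \<open>w\<close> is dominated by exponentials of small multiples of \<open>w\<close> and of \<open>- w\<close>. These are
  integrable under the tilted density because the parameter is interior.\<close>
lemma exp_density_second_moment:
  assumes p: "p \<in> densities M" and \<theta>: "\<theta> \<in> params M p u" and w: "w \<in> Bspace M p"
  shows "integrable M (\<lambda>x. (w x)\<^sup>2 * exp_density M p u \<theta> x)"
proof -
  let ?l = "lin_comb u \<theta>"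
  obtain s where s: "s > 0" "integrable M (\<lambda>x. exp (?l x + s * w x) * p x)"
    using params_tilt[OF p \<theta> w] by blast
  have "(\<lambda>x. - 1 * w x) \<in> Bspace M p"
    by (rule Bspace_scale[OF p w])
  then obtain r where r: "r > 0" "integrable M (\<lambda>x. exp (?l x + r * (- 1 * w x)) * p x)"
    using params_tilt[OF p \<theta>] by blast
  have square: "y\<^sup>2 \<le> 2 / a\<^sup>2 * exp (a * y)" if "a > 0" "y \<ge> 0" for a y :: real
  proof -
    have "(a * y)\<^sup>2 / 2 \<le> exp (a * y)"
      using exp_lower_Taylor_quadratic[of "a * y"] that
      by (smt (verit) mult_nonneg_nonneg)
    then show ?thesis using that by (simp add: power_mult_distrib field_simps)
  qed
  let ?g = "\<lambda>x. 2 / s\<^sup>2 * exp (?l x + s * w x) + 2 / r\<^sup>2 * exp (?l x + r * (- 1 * w x))"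
  have "(w x)\<^sup>2 * exp (?l x) \<le> ?g x" for x
  proof -
    have "(w x)\<^sup>2 \<le> 2 / s\<^sup>2 * exp (s * w x) + 2 / r\<^sup>2 * exp (r * (- 1 * w x))"
    proof (cases "w x \<ge> 0")
      case True
      have "0 \<le> 2 / r\<^sup>2 * exp (r * (- 1 * w x))" by simp
      then show ?thesis using square[OF s(1) True] by linarith
    next
      case False
      have "0 \<le> 2 / s\<^sup>2 * exp (s * w x)" by simp
      moreover have "(w x)\<^sup>2 \<le> 2 / r\<^sup>2 * exp (r * (- 1 * w x))"
        using square[OF r(1), of "- 1 * w x"] False by simp
      ultimately show ?thesis by linarith
    qed
    then have "(w x)\<^sup>2 * exp (?l x)
        \<le> (2 / s\<^sup>2 * exp (s * w x) + 2 / r\<^sup>2 * exp (r * (- 1 * w x))) * exp (?l x)"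
      by (rule mult_right_mono) simp
    then show ?thesis unfolding exp_add by (simp only: distrib_left distrib_right mult_ac)
  qed
  then have bound: "\<bar>(w x)\<^sup>2 * exp (?l x)\<bar> \<le> ?g x" for x by simp
  have "integrable M (\<lambda>x. ?g x * p x)"
    using Bochner_Integration.integrable_add[OF integrable_mult_right[OF s(2), of "2 / s\<^sup>2"]
        integrable_mult_right[OF r(2), of "2 / r\<^sup>2"]]
    by (simp add: distrib_right mult.assoc)
  moreover have "(\<lambda>x. (w x)\<^sup>2 * exp (?l x)) \<in> borel_measurable M"
    using Bspace_measurable[OF w] Bspace_measurable[OF params_Bspace[OF \<theta>]] by measurable
  ultimately have "integrable M (\<lambda>x. (w x)\<^sup>2 * exp (?l x) * p x)"
    by (rule integrable_weight_bound[OF p _ _ bound, rotated])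
  then have "integrable M (\<lambda>x. (w x)\<^sup>2 * exp (?l x) * p x / expect M p (\<lambda>x. exp (?l x)))"
    by simp
  then show ?thesis
    unfolding exp_density_eq[OF p \<theta>] by (simp only: times_divide_eq_right mult.assoc)
qed

section \<open>Second moment matrices\<close>

lemma sum_option: "(\<Sum>a\<in>UNIV. f a) = f None + (\<Sum>k\<in>UNIV. f (Some k))"
  for f :: "'r::finite option \<Rightarrow> 'b::comm_monoid_add"
  by (simp add: UNIV_option_conv sum.reindex)

text \<open>The quadratic form of a second moment matrix at \<open>v\<close> is the expectation of the square of
  \<open>v \<bullet> ext_stat u j x\<close>, so it vanishes only on almost sure linear relations.\<close>
lemma partial_embedding_SPD:
  fixes j :: "'r::finite \<Rightarrow> 'd"
  assumes q: "q \<in> densities M" and um: "\<And>k. u (j k) \<in> borel_measurable M"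
    and sq: "\<And>k. integrable M (\<lambda>x. (u (j k) x)\<^sup>2 * q x)"
    and indep: "\<And>v :: real^'r option. AE x in M. v \<bullet> ext_stat u j x = 0 \<Longrightarrow> v = 0"
  shows "partial_embedding M u j q \<in> SPD"
proof (rule SPD_I)
  let ?S = "partial_embedding M u j q"
  let ?V = "\<lambda>x a. ext_stat u j x $ a"
  show "transpose ?S = ?S"
    by (simp add: partial_embedding_def transpose_def vec_eq_iff mult.commute)
  have Vm: "(\<lambda>x. ?V x a) \<in> borel_measurable M" for a
    by (cases a) (auto simp: ext_stat_def um)
  have Vsq: "integrable M (\<lambda>x. (?V x a)\<^sup>2 * q x)" for a
    by (cases a) (auto simp: ext_stat_def sq densitiesD(3)[OF q])
  have VV: "integrable M (\<lambda>x. ?V x a * ?V x b * q x)" for a b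
  proof (rule integrable_weight_bound[OF q])
    show "integrable M (\<lambda>x. ((?V x a)\<^sup>2 + (?V x b)\<^sup>2) * q x)"
      using Bochner_Integration.integrable_add[OF Vsq[of a] Vsq[of b]] by (simp add: distrib_right)
    show "\<bar>?V x a * ?V x b\<bar> \<le> (?V x a)\<^sup>2 + (?V x b)\<^sup>2" for x
    proof -
      have "0 \<le> (\<bar>?V x a\<bar> - \<bar>?V x b\<bar>)\<^sup>2" "0 \<le> \<bar>?V x a * ?V x b\<bar>" by simp_all
      then show ?thesis unfolding power2_diff power2_abs abs_mult by linarith
    qed
  qed (use Vm in measurable)
  fix v :: "real^'r option" assume "v \<noteq> 0"
  let ?f = "\<lambda>x. (v \<bullet> ext_stat u j x)\<^sup>2 * q x"
  have f: "?f x = (\<Sum>a\<in>UNIV. \<Sum>b\<in>UNIV. v $ a * v $ b * (?V x a * ?V x b * q x))" for x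
    unfolding inner_vec_def inner_real_def power2_eq_square sum_product
    unfolding sum_distrib_right by (simp only: mult_ac)
  have int: "integrable M ?f"
    unfolding f by (intro Bochner_Integration.integrable_sum integrable_mult_right VV)
  have "(\<integral>x. ?f x \<partial>M) = (\<Sum>a\<in>UNIV. \<Sum>b\<in>UNIV. v $ a * v $ b * (\<integral>x. ?V x a * ?V x b * q x \<partial>M))"
    unfolding f
    by (simp add: Bochner_Integration.integral_sum VV)
  also have "\<dots> = v \<bullet> (?S *v v)"
    by (simp add: inner_vec_def matrix_vector_mult_def partial_embedding_def expect_def
        sum_distrib_left mult_ac)
  finally have eq: "v \<bullet> (?S *v v) = (\<integral>x. ?f x \<partial>M)" ..
  have nonneg: "AE x in M. 0 \<le> ?f x"
    using densitiesD(2)[OF q] by eventually_elim simp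
  have "(\<integral>x. ?f x \<partial>M) \<noteq> 0"
  proof
    assume "(\<integral>x. ?f x \<partial>M) = 0"
    then have "AE x in M. ?f x = 0" using integral_nonneg_eq_0_iff_AE[OF int nonneg] by simp
    then have "AE x in M. v \<bullet> ext_stat u j x = 0"
      using densitiesD(2)[OF q] by eventually_elim auto
    then show False using indep \<open>v \<noteq> 0\<close> by blast
  qed
  moreover have "0 \<le> (\<integral>x. ?f x \<partial>M)" by (rule integral_nonneg_AE[OF nonneg])
  ultimately show "0 < v \<bullet> (?S *v v)" by (simp add: eq)
qed

text \<open>The statistics have mean zero under \<open>p\<close>. Taking the \<open>p\<close>-expectation of a linear relation
  therefore removes the constant, and a relation among the statistics alone is left.\<close>
lemma ext_stat_independent:
  fixes j :: "'r::finite \<Rightarrow> 'd::finite" and v :: "real^'r option"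
  assumes p: "p \<in> densities M" and u: "\<And>k. u k \<in> Bspace M p" and indep: "L2_lin_indep M p u"
    and j: "inj j" and rel: "AE x in M. v \<bullet> ext_stat u j x = 0"
  shows "v = 0"
proof -
  have expand: "v \<bullet> ext_stat u j x = v $ None + (\<Sum>k\<in>UNIV. v $ Some k * u (j k) x)" for x
    by (simp add: inner_vec_def sum_option ext_stat_def)
  have "(\<integral>x. (v \<bullet> ext_stat u j x) * p x \<partial>M) = 0"
    by (rule integral_eq_zero_AE) (use rel in \<open>auto elim: eventually_mono\<close>)
  also have "(\<integral>x. (v \<bullet> ext_stat u j x) * p x \<partial>M)
      = (\<integral>x. v $ None * p x + (\<Sum>k\<in>UNIV. v $ Some k * (u (j k) x * p x)) \<partial>M)"
    by (simp add: expand distrib_right sum_distrib_right mult.assoc)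
  also have "\<dots> = v $ None * (\<integral>x. p x \<partial>M)
      + (\<Sum>k\<in>UNIV. v $ Some k * (\<integral>x. u (j k) x * p x \<partial>M))"
    using densitiesD(3)[OF p] Bspace_integrable[OF p u]
    by (subst Bochner_Integration.integral_add) (auto simp: Bochner_Integration.integral_sum)
  also have "\<dots> = v $ None"
    using u densitiesD(4)[OF p] by (simp add: Bspace_def expect_def)
  finally have None: "v $ None = 0" .
  \<comment> \<open>the relation as one among all statistics, with coefficient zero outside the range of \<open>j\<close>\<close>
  define c where "c i = (\<Sum>k\<in>UNIV. if j k = i then v $ Some k else 0)" for i
  have "(\<Sum>i\<in>UNIV. c i * u i x) = (\<Sum>k\<in>UNIV. v $ Some k * u (j k) x)" for x
  proof -
    have "(\<Sum>i\<in>UNIV. c i * u i x) = (\<Sum>i\<in>UNIV. \<Sum>k\<in>UNIV. if j k = i then v $ Some k * u i x else 0)"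
      by (simp add: c_def sum_distrib_right if_distrib[of "\<lambda>y. y * _"] cong: if_cong)
    also have "\<dots> = (\<Sum>k\<in>UNIV. \<Sum>i\<in>UNIV. if j k = i then v $ Some k * u i x else 0)"
      by (rule sum.swap)
    finally show ?thesis by simp
  qed
  then have "AE x in M. (\<Sum>i\<in>UNIV. c i * u i x) = 0"
    using rel None by (simp add: expand)
  then have "AE x in density M (\<lambda>x. ennreal (p x)). (\<Sum>i\<in>UNIV. c i * u i x) = 0"
    using densitiesD(1)[OF p] by (subst AE_density) auto
  then have "c i = 0" for i using indep unfolding L2_lin_indep_def by blast
  moreover have "c (j k) = v $ Some k" for k
    using j by (simp add: c_def inj_eq)
  ultimately have "v $ Some k = 0" for k by metis
  then have "v $ a = 0" for a using None by (cases a) auto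
  then show ?thesis by (simp add: vec_eq_iff)
qed

lemma exp_density_embedding_SPD:
  fixes j :: "'r::finite \<Rightarrow> 'd::finite"
  assumes p: "p \<in> densities M" and u: "\<And>k. u k \<in> Bspace M p" and indep: "L2_lin_indep M p u"
    and j: "inj j" and \<theta>: "\<theta> \<in> params M p u"
  shows "partial_embedding M u j (exp_density M p u \<theta>) \<in> SPD"
  by (rule partial_embedding_SPD[OF exp_density_densities[OF p \<theta>] Bspace_measurable[OF u]
        exp_density_second_moment[OF p \<theta> u] ext_stat_independent[OF p u indep j]])

lemma partial_embedding_last_column:
  assumes q: "q \<in> densities M"
  shows "partial_embedding M u j q *v axis None 1
    = (\<chi> a. case a of Some k \<Rightarrow> partial_mean M u j q $ k | None \<Rightarrow> 1)"
  using densitiesD(4)[OF q]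
  by (simp add: matrix_vector_mult_basis column_def vec_eq_iff partial_embedding_def
      partial_mean_def ext_stat_def expect_def split: option.split)

lemma fixed_mean_SPD_I:
  fixes S :: "real^'r::finite option^'r option"
  assumes S: "S \<in> SPD" and col: "S *v axis None 1 = (\<chi> a. case a of Some k \<Rightarrow> \<eta> $ k | None \<Rightarrow> 1)"
  shows "S \<in> fixed_mean_SPD \<eta>"
proof -
  define A where "A = (\<chi> i k. S $ Some i $ Some k)"
  have last: "S $ a $ None = (case a of Some k \<Rightarrow> \<eta> $ k | None \<Rightarrow> 1)" for a
    using arg_cong[OF col, of "\<lambda>z. z $ a"] by (simp add: matrix_vector_mult_basis column_def)
  have sym: "S $ a $ b = S $ b $ a" for a b
    using arg_cong[OF SPD_D(1)[OF S], of "\<lambda>Z. Z $ b $ a"] by (simp add: transpose_def)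
  have "S $ a $ b = bordered A \<eta> $ a $ b" for a b
    by (cases a; cases b) (simp_all add: bordered_def A_def last sym[of None])
  then have eq: "S = bordered A \<eta>" by (simp add: vec_eq_iff)
  have "A \<in> SPD"
  proof (rule SPD_I)
    show "transpose A = A" using sym by (simp add: A_def transpose_def vec_eq_iff)
  next
    fix v :: "real^'r" assume v: "v \<noteq> 0"
    \<comment> \<open>on vectors padded with a zero, the form of \<open>S\<close> is that of its principal submatrix \<open>A\<close>\<close>
    define v' where "v' = (\<chi> a. case a of Some k \<Rightarrow> v $ k | None \<Rightarrow> 0)"
    obtain k where "v $ k \<noteq> 0" using v by (auto simp: vec_eq_iff)
    then have "v' $ Some k \<noteq> 0" by (simp add: v'_def)
    then have "v' \<noteq> 0" by auto
    from SPD_D(2)[OF S this] show "0 < v \<bullet> (A *v v)"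
      by (simp add: inner_vec_def matrix_vector_mult_def sum_option v'_def A_def)
  qed
  then show ?thesis using S eq unfolding fixed_mean_SPD_def by blast
qed

section \<open>The geodesic between two members with equal partial means\<close>

theorem corollary6p6:
  fixes M :: "'a measure"
    and p :: "'a \<Rightarrow> real"
    and u :: "'d::{finite, linorder} \<Rightarrow> 'a \<Rightarrow> real"
    and J :: "'d set"
    and j :: "'r::{finite, linorder} \<Rightarrow> 'd"
    and \<theta>1 \<theta>2 :: "real^('d::{finite, linorder})"
    and \<eta>0 :: "real^('r::{finite, linorder})"
  assumes "sigma_finite_measure M"
    and "p \<in> densities M"
    and "\<And>k. u k \<in> Bspace M p"
    and "L2_lin_indep M p u"
    and "J \<noteq> {}"
    and "strict_mono j" and "range j = J"
    and "\<theta>1 \<in> params M p u" and "\<theta>2 \<in> params M p u"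
    and "partial_mean M u j (exp_density M p u \<theta>1) = \<eta>0"
    and "partial_mean M u j (exp_density M p u \<theta>2) = \<eta>0"
  defines "S1 \<equiv> partial_embedding M u j (exp_density M p u \<theta>1)"
    and "S2 \<equiv> partial_embedding M u j (exp_density M p u \<theta>2)"
  shows "airm_geodesic S1 S2 ` {0..1} \<subseteq> fixed_mean_SPD \<eta>0
    \<and> (airm_geodesic S1 S2 ` {0..1} \<subseteq> embedded_family M p u j
         \<longrightarrow> ereal (airm_dist S1 S2) = embedding_dist M p u j \<theta>1 \<theta>2)"
proof
  let ?c = "\<chi> a. case a of Some k \<Rightarrow> \<eta>0 $ k | None \<Rightarrow> 1"
  have j: "inj j" using \<open>strict_mono j\<close> by (rule strict_mono_imp_inj_on)
  have S: "S1 \<in> SPD" "S2 \<in> SPD"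
    unfolding S1_def S2_def using assms(2-4,8,9) j by (auto intro: exp_density_embedding_SPD)
  have c: "S1 *v axis None 1 = ?c" "S2 *v axis None 1 = ?c"
    unfolding S1_def S2_def
    using partial_embedding_last_column[OF exp_density_densities[OF assms(2,8)], of u j]
      partial_embedding_last_column[OF exp_density_densities[OF assms(2,9)], of u j]
    unfolding assms(10,11) .
  show "airm_geodesic S1 S2 ` {0..1} \<subseteq> fixed_mean_SPD \<eta>0"
  proof
    fix X assume "X \<in> airm_geodesic S1 S2 ` {0..1}"
    then obtain t where X: "X = airm_geodesic S1 S2 t" by blast
    show "X \<in> fixed_mean_SPD \<eta>0"
      unfolding X using airm_geodesic_fixes[OF S, of "axis None 1"] c
      by (intro fixed_mean_SPD_I airm_geodesic_SPD S) simp
  qed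
  show "airm_geodesic S1 S2 ` {0..1} \<subseteq> embedded_family M p u j
      \<longrightarrow> ereal (airm_dist S1 S2) = embedding_dist M p u j \<theta>1 \<theta>2"
    using intrinsic_dist_eq_airm_dist[OF S] by (simp add: embedding_dist_def S1_def S2_def)
qed

end
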